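(* Let $S=\{a_n\}_{n\in\mathbb N}$ be a sequence of complex numbers satisfying (i)–(iii) of the context, with exponent of convergence $\alpha$, and let $F(z)=\sum_{j=0}^\infty c_jz^j$ be a characteristic function of $S$ of minimal growth order. Assume that a holomorphic branch of $\ln F$ in the sector $\mathcal I_\varepsilon^c$ has an asymptotic expansion $$\ln F(z)=\sum_{j=0}^N\sum_{k=0}^M d_{j,k}\,z^{\alpha-(j/m)}\ln^k z+o\big(z^{\alpha-(N/m)-\delta}\big),\qquad z\to\infty,\ z\in\mathcal I_\varepsilon^c,$$ valid to all orders, i.e. with a fixed integer $m\ge1$ and fixed coefficients $d_{j,k}$, it holds for arbitrarily large $N$ and (correspondingly large) $M$ with some $\delta>0$. Let $n\in\mathbb Z\setminus\{0\}$ with $n\le\alpha$ be a regular point of (the analytic continuation of) $\zeta_S(s)$. Then $$\zeta_S(n)=\begin{cases}-nb_n,&\text{if }\alpha-(j/m)\ne n\text{ for all }j\in\mathbb N_0\text{ and }1\le n\le\alpha,\\ n\,(d_{m(\alpha-n),0}-b_n),&\text{if }\alpha-(\tilde j/m)=n\text{ for some }\tilde j\in\mathbb N_0\text{ and }1\le n\le\alpha,\\ 0,&\text{if }\alpha-(j/m)\ne n\text{ for all }j\in\mathbb N_0\text{ and }n<0,\\ n\,d_{m(\alpha-n),0},&\text{if }\alpha-(\tilde j/m)=n\text{ for some }\tilde j\in\mathbb N_0\text{ and }n<0,\end{cases}$$ where $$b_1=\frac{c_1}{c_0},\qquad b_j=\frac{c_j}{c_0}-\sum_{\ell=1}^{j-1}\left(\frac{\ell}{j}\right)\frac{c_{j-\ell}}{c_0}b_\ell,\quad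 j\ge2.$$ If the expansion is only valid for some $M,N$ (and $\delta>0$ with $N/m>\alpha-\delta$), then the same formulas, with $j,\tilde j$ ranging over $\{0,1,\dots,N\}$, hold for those $n$ with $n>\alpha-(N/m)-\delta$.
   Context: Assumptions on $S=\{a_n\}_{n\in\mathbb N}\subset\mathbb C$: (i) $0<|a_1|\le|a_2|\le\dots\to\infty$; (ii) $\alpha=\limsup_{n\to\infty}(\ln n)/(\ln|a_n|)$ is finite; (iii) there exist $\varepsilon>0$ and $\Psi\in[-\pi,\pi)$ such that all $a_n\in\mathcal I_\varepsilon=\{z\in\mathbb C:\operatorname{Arg}(z)\notin(\Psi-\varepsilon,\Psi+\varepsilon)\}$ (arguments modulo $2\pi$); $\mathcal I_\varepsilon^c$ is the complementary sector around the ray $R_\Psi=\{te^{i\Psi}:t\ge0\}$. The $\zeta$-function is $\zeta_S(s)=\sum_{n=1}^\infty a_n^{-s}$ for $\Re(s)>\alpha$, with branch cut along $R_\Psi$: $z^{-s}=\exp(-s(\ln|z|+i\theta))$, $\theta\in(\Psi-2\pi,\Psi)$ being the argument of $z$; the expansion with given $N,\delta$ yields a meromorphic continuation to $\Re(s)>\alpha-(N/m)-\delta$. A characteristic function of $S$ of minimal growth order is an entire function $F=e^{\omega}H$ with $\omega$ a polynomial of degree at most $\lfloor\alpha\rfloor$ and $H(z)=\prod_{n=1}^{\infty}(1-z/a_n)\exp\big[\sum_{j=1}^{\lfloor\alpha\rfloor}\frac1j(z/a_n)^j\big]$. In the asymptotic expansion, for $z\in\mathcal I_\varepsilon^c$,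 $\ln z=\ln|z|+i\theta$ with $\theta\in(\Psi-\varepsilon,\Psi+\varepsilon)$ the argument of $z$, and $z^\beta=e^{\beta\ln z}$. $\mathbb N_0=\{0,1,2,\dots\}$. *)

theory Defs
  imports
    "HOL-Complex_Analysis.Complex_Analysis"
    "HOL-Library.Landau_Symbols"
    "HOL-Computational_Algebra.Polynomial"
begin

text \<open>
  A sequence \<open>a\<^sub>1, a\<^sub>2, \<dots>\<close> is a function \<open>a :: nat \<Rightarrow> complex\<close> whose value at \<open>0\<close> is ignored
  everywhere; series and products over \<open>n \<ge> 1\<close> are written over all \<open>n\<close> with \<open>a (Suc n)\<close>.
\<close>

text \<open>
  The open sector of half-angle \<open>\<epsilon>\<close> around the ray with argument \<open>\<psi>\<close>. Quantifying over
  \<open>\<theta>\<close> takes care of arguments modulo \<open>2\<pi>\<close>. The origin, which has no argument, is left out.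
\<close>
definition ray_sector :: "real \<Rightarrow> real \<Rightarrow> complex set" where
  "ray_sector \<psi> \<epsilon> =
     {z. z \<noteq> 0 \<and> (\<exists>\<theta>\<in>{\<psi> - \<epsilon><..<\<psi> + \<epsilon>}. is_Arg z \<theta>)}"

text \<open>
  Logarithm and power with the argument taken in the set \<open>T\<close>. They are only used at points
  having exactly one argument in \<open>T\<close>.
\<close>
definition ln_on :: "real set \<Rightarrow> complex \<Rightarrow> complex" where
  "ln_on T z = of_real (ln (norm z)) + \<i> * of_real (THE \<theta>. \<theta> \<in> T \<and> is_Arg z \<theta>)"

definition pow_on :: "real set \<Rightarrow> complex \<Rightarrow> complex \<Rightarrow> complex" where
  "pow_on T z s = exp (s * ln_on T z)"

definition seq_zeta :: "(nat \<Rightarrow> complex) \<Rightarrow> real \<Rightarrow> complex \<Rightarrow> complex" where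
  "seq_zeta a \<psi> s = (\<Sum>n. pow_on {\<psi> - 2 * pi<..<\<psi>} (a (Suc n)) (- s))"

text \<open>
  Requiring \<open>Z\<close> to be nicely meromorphic (no removable singularities with a wrong value, and the
  value \<open>0\<close> at poles) makes the continuation to a connected open \<open>U\<close> unique on \<open>U\<close>.
\<close>
definition zeta_continuation ::
    "(nat \<Rightarrow> complex) \<Rightarrow> real \<Rightarrow> real \<Rightarrow> complex set \<Rightarrow> (complex \<Rightarrow> complex) \<Rightarrow> bool" where
  "zeta_continuation a \<psi> \<alpha> U Z \<longleftrightarrow>
     Z nicely_meromorphic_on U \<and> (\<forall>s. Re s > \<alpha> \<longrightarrow> Z s = seq_zeta a \<psi> s)"

definition min_order_char_fun :: "(nat \<Rightarrow> complex) \<Rightarrow> real \<Rightarrow> (complex \<Rightarrow> complex) \<Rightarrow> bool" where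
  "min_order_char_fun a \<alpha> F \<longleftrightarrow>
     (\<exists>\<omega> :: complex poly. degree \<omega> \<le> nat \<lfloor>\<alpha>\<rfloor> \<and>
        (\<forall>z. F z = exp (poly \<omega> z) * (\<Prod>n. weierstrass_factor (nat \<lfloor>\<alpha>\<rfloor>) (z / a (Suc n)))))"

definition log_expansion ::
    "(complex \<Rightarrow> complex) \<Rightarrow> real \<Rightarrow> real \<Rightarrow> real \<Rightarrow> nat \<Rightarrow> (nat \<Rightarrow> nat \<Rightarrow> complex)
      \<Rightarrow> nat \<Rightarrow> nat \<Rightarrow> real \<Rightarrow> bool" where
  "log_expansion L \<psi> \<epsilon> \<alpha> m d N M \<delta> \<longleftrightarrow>
     (let T = {\<psi> - \<epsilon><..<\<psi> + \<epsilon>} in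
      (\<lambda>z. L z - (\<Sum>j=0..N. \<Sum>k=0..M.
           d j k * pow_on T z (of_real (\<alpha> - real j / real m)) * ln_on T z ^ k))
      \<in> o[inf at_infinity (principal (ray_sector \<psi> \<epsilon>))](\<lambda>z.
            pow_on T z (of_real (\<alpha> - real N / real m - \<delta>))))"

text \<open>
  The value of the continued zeta function at \<open>n\<close>, where \<open>J\<close> is the range of the index of the
  powers in the expansion. If \<open>\<alpha> - j/m = n\<close>, then \<open>j = m(\<alpha> - n)\<close>, so \<open>d j 0\<close> is the coefficient
  of the pure power \<open>z\<^sup>n\<close>.
\<close>
definition zeta_value_formula ::
    "(complex \<Rightarrow> complex) \<Rightarrow> real \<Rightarrow> nat \<Rightarrow> (nat \<Rightarrow> nat \<Rightarrow> complex) \<Rightarrow> (nat \<Rightarrow> complex)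
      \<Rightarrow> nat set \<Rightarrow> int \<Rightarrow> bool" where
  "zeta_value_formula Z \<alpha> m d b J n \<longleftrightarrow>
     (1 \<le> n \<and> (\<forall>j\<in>J. \<alpha> - real j / real m \<noteq> real_of_int n) \<longrightarrow>
        Z (of_int n) = - of_int n * b (nat n)) \<and>
     (\<forall>j\<in>J. 1 \<le> n \<and> \<alpha> - real j / real m = real_of_int n \<longrightarrow>
        Z (of_int n) = of_int n * (d j 0 - b (nat n))) \<and>
     (n < 0 \<and> (\<forall>j\<in>J. \<alpha> - real j / real m \<noteq> real_of_int n) \<longrightarrow>
        Z (of_int n) = 0) \<and>
     (\<forall>j\<in>J. n < 0 \<and> \<alpha> - real j / real m = real_of_int n \<longrightarrow>
        Z (of_int n) = of_int n * d j 0)"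

end

theory Submission
  imports Defs "HOL-Real_Asymp.Real_Asymp"
begin

text \<open>
  The idea is to see the zeta function as a bilateral Laplace transform of \<open>ln F\<close> along the ray with
  argument \<open>\<psi>\<close>. Write \<open>p = \<lfloor>\<alpha>\<rfloor>\<close> and
  \<open>\<Lambda>(w) = ln (1 + w) + (\<Sum>j=1..p. (-w)^j / j)\<close>, so that \<open>exp (\<Lambda> (-z/a))\<close> is the Weierstrass factor of \<open>a\<close>.
  For \<open>z = exp (u + \<i>\<psi>)\<close> with real \<open>u\<close> one has \<open>-z/a\<^sub>n = exp (u + \<tau>\<^sub>n)\<close>, where \<open>\<tau>\<^sub>n\<close> is \<open>\<i>(\<psi> - \<pi>)\<close> minus
  the logarithm of \<open>a\<^sub>n\<close> used in the zeta function; the sector condition says exactly that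
  \<open>\<bar>Im \<tau>\<^sub>n\<bar> \<le> \<pi> - \<epsilon>\<close>. Hence on the ray \<open>ln F = \<omega> + h + const\<close> with \<open>h(u) = (\<Sum>n. \<Lambda>(exp (u + \<tau>\<^sub>n)))\<close>, and a
  term-by-term transform (\<open>genus_log_series_mellin\<close>) gives, for \<open>\<alpha> < Re s < p + 1\<close>,
  \<open>\<integral> e^(-su) h(u) du = \<pi> / (s sin \<pi>s) * (\<Sum>n. exp (s \<tau>\<^sub>n))\<close>; the last sum is the zeta function up to the factor
  \<open>exp (\<i>s(\<psi> - \<pi>))\<close>.

  The single transform \<open>\<integral> e^(-su) \<Lambda>(exp (u + \<tau>)) du = e^(s\<tau>) \<pi> / (s sin \<pi>s)\<close> (\<open>genus_log_mellin\<close>) is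
  found by analytic continuation in \<open>\<tau>\<close>: for real \<open>\<tau>\<close> it is a translation of the case \<open>\<tau> = 0\<close>, which an integration by parts
  reduces to a Beta integral, and both sides are holomorphic in the strip \<open>\<bar>Im \<tau>\<bar> < \<pi>\<close>.

  To continue the transform to the left one only has to treat \<open>u \<ge> 0\<close>, since \<open>h\<close> is
  \<open>O(e^((p+1)u))\<close> for \<open>u \<rightarrow> -\<infinity>\<close>. There \<open>h\<close> is \<open>ln F - \<omega> - const\<close>, so by the assumed expansion it is a
  finite sum of terms \<open>q z^\<beta> (ln z)^k\<close> up to \<open>O(e^(\<eta>u))\<close> with \<open>\<eta> = \<alpha> - N/m - \<delta>\<close>. Such a
  term contributes to \<open>exp (-\<i>\<psi>s)\<close> times the transform \<open>q k! / (s - \<beta>)^(k+1)\<close> up to an entire function (\<open>laplace_ray_power\<close>,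
  \<open>laplace_continuation\<close>). Altogether (\<open>zeta_on_strip\<close>)
  \<open>\<zeta>(s) = s sin(\<pi>s) e^(\<i>\<pi>s) / \<pi> * (H(s) + (\<Sum> q\<^sub>i k\<^sub>i! / (s - \<beta>\<^sub>i)^(k\<^sub>i+1)))\<close> with \<open>H\<close> holomorphic for
  \<open>\<eta> < Re s < p + 1\<close>, which is the meromorphic continuation.

  The factor in front has a simple zero with derivative \<open>n\<close> at each integer \<open>n \<noteq> 0\<close>. So at a regular
  point \<open>n\<close> only the terms with \<open>\<beta>\<^sub>i = n\<close> matter; those with \<open>k\<^sub>i > 0\<close> must cancel, because the value is finite,
  and the value is \<open>n\<close> times the sum of the remaining \<open>q\<^sub>i\<close> (\<open>value_at_regular_point\<close>).
  These come from the coefficient \<open>d j 0\<close> with \<open>\<alpha> - j/m = n\<close> and from the coefficient of \<open>z^n\<close> in \<open>-\<omega>\<close>.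
  Since \<open>F = e^\<omega> (1 + O(z^(p+1)))\<close> at the origin, the coefficients of \<open>\<omega>\<close> of index \<open>1,\<dots>,p\<close> are the
  Taylor coefficients \<open>b\<^sub>j\<close> of \<open>ln F\<close> (\<open>log_coefficients_unique\<close>).
\<close>

section \<open>Bilateral Laplace transforms\<close>

text \<open>
  Differentiation under the integral sign for integrands depending holomorphically on the parameter. Cauchy's
  inequality turns the bound \<open>g\<close> on the integrand into a bound on its derivative, hence on the
  difference quotients, so a dominating function for the integrand itself is enough. Any measure is
  allowed; counting measure yields the corresponding statement for series.
\<close>
lemma has_field_derivative_lebesgue_integral:
  fixes f :: "complex \<Rightarrow> 'a \<Rightarrow> complex"
  assumes r: "r > 0"
    and holo: "\<And>t. t \<in> space M \<Longrightarrow> (\<lambda>z. f z t) holomorphic_on ball z0 r"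
    and meas: "\<And>z. z \<in> ball z0 r \<Longrightarrow> f z \<in> borel_measurable M"
    and g: "integrable M g"
    and bound: "\<And>z t. z \<in> ball z0 r \<Longrightarrow> t \<in> space M \<Longrightarrow> norm (f z t) \<le> g t"
  shows "((\<lambda>z. \<integral>t. f z t \<partial>M) has_field_derivative
           (\<integral>t. deriv (\<lambda>z. f z t) z0 \<partial>M)) (at z0)"
proof -
  let ?F = "\<lambda>z. \<integral>t. f z t \<partial>M"
  \<comment> \<open>Outside the half-radius ball, where no bound on the difference quotient is available, it is replaced by 0.\<close>
  define Q where "Q = (\<lambda>y t. if y \<in> ball z0 (r/2) then (f y t - f z0 t) / (y - z0) else 0)"
  have z0: "z0 \<in> ball z0 r" using r by simp
  have int: "integrable M (f z)" if "z \<in> ball z0 r" for z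
    by (rule Bochner_Integration.integrable_bound[OF g])
       (use meas that bound in \<open>auto intro!: AE_I2 order_trans[OF bound]\<close>)
  have dbound: "norm (deriv (\<lambda>z. f z t) y) \<le> 2 / r * g t"
    if y: "y \<in> ball z0 (r/2)" and t: "t \<in> space M" for y t
  proof -
    have sub: "cball y (r/2) \<subseteq> ball z0 r"
    proof
      fix x assume "x \<in> cball y (r/2)"
      with y have "dist z0 y < r/2" "dist y x \<le> r/2" by auto
      with dist_triangle[of z0 x y] show "x \<in> ball z0 r" by simp
    qed
    have "norm ((deriv ^^ 1) (\<lambda>z. f z t) y) \<le> fact 1 * g t / (r/2) ^ 1"
    proof (rule Cauchy_inequality)
      show "(\<lambda>z. f z t) holomorphic_on ball y (r/2)"
        using holo[OF t] sub by (meson ball_subset_cball holomorphic_on_subset order_trans)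
      show "continuous_on (cball y (r/2)) (\<lambda>z. f z t)"
        using holo[OF t] sub by (meson continuous_on_subset holomorphic_on_imp_continuous_on)
      show "norm (f x t) \<le> g t" if "norm (y - x) = r/2" for x
        using that sub t by (intro bound) (auto simp: dist_norm subset_iff)
    qed (use r in auto)
    thus ?thesis by (simp add: field_simps)
  qed
  have Qbound: "norm (Q y t) \<le> 2 / r * g t" if t: "t \<in> space M" and "y \<noteq> z0" for y t
  proof (cases "y \<in> ball z0 (r/2)")
    case True
    have "norm (f y t - f z0 t) \<le> 2 / r * g t * norm (y - z0)"
    proof (rule field_differentiable_bound[where S = "ball z0 (r/2)"])
      show "((\<lambda>z. f z t) has_field_derivative deriv (\<lambda>z. f z t) z) (at z within ball z0 (r/2))"
        if "z \<in> ball z0 (r/2)" for z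
        by (rule has_field_derivative_at_within, rule holomorphic_derivI[OF holo[OF t]])
           (use that r in auto)
    qed (use dbound t True r in auto)
    with True that show ?thesis
      by (simp add: Q_def norm_divide field_simps)
  next
    case False
    have "0 \<le> g t" using order_trans[OF norm_ge_zero bound[OF z0 t]] .
    with False r show ?thesis unfolding Q_def by (auto intro!: mult_nonneg_nonneg divide_nonneg_pos)
  qed
  have "((\<lambda>y. (?F y - ?F z0) / (y - z0)) \<longlongrightarrow> (\<integral>t. deriv (\<lambda>z. f z t) z0 \<partial>M)) (at z0)"
    unfolding tendsto_at_iff_sequentially o_def
  proof (intro allI impI)
    fix X assume X: "\<forall>i. X i \<in> UNIV - {z0}" "X \<longlonglongrightarrow> z0"
    have Xev: "\<forall>\<^sub>F n in sequentially. X n \<in> ball z0 (r/2)"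
      using X(2) r by (metis open_ball topological_tendstoD centre_in_ball half_gt_zero)
    have lim: "(\<lambda>n. Q (X n) t) \<longlonglongrightarrow> deriv (\<lambda>z. f z t) z0" if t: "t \<in> space M" for t
    proof -
      have "((\<lambda>z. f z t) has_field_derivative deriv (\<lambda>z. f z t) z0) (at z0)"
        by (rule holomorphic_derivI[OF holo[OF t]]) (use r in auto)
      hence "(\<lambda>n. (f (X n) t - f z0 t) / (X n - z0)) \<longlonglongrightarrow> deriv (\<lambda>z. f z t) z0"
        unfolding has_field_derivative_iff tendsto_at_iff_sequentially o_def using X by blast
      thus ?thesis
        by (rule Lim_transform_eventually) (use Xev in eventually_elim, auto simp: Q_def)
    qed
    have Qmeas: "Q (X n) \<in> borel_measurable M" for n
    proof (cases "X n \<in> ball z0 (r/2)")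
      case True
      hence "X n \<in> ball z0 r" using r by auto
      note [measurable] = meas[OF this] meas[OF z0]
      from True show ?thesis unfolding Q_def by simp
    qed (simp add: Q_def)
    have "(\<lambda>n. \<integral>t. Q (X n) t \<partial>M) \<longlonglongrightarrow> (\<integral>t. deriv (\<lambda>z. f z t) z0 \<partial>M)"
    proof (rule integral_dominated_convergence[where w = "\<lambda>t. 2 / r * g t"])
      show "(\<lambda>t. deriv (\<lambda>z. f z t) z0) \<in> borel_measurable M"
        by (rule borel_measurable_LIMSEQ_metric[OF Qmeas lim])
      show "integrable M (\<lambda>t. 2 / r * g t)" using g by simp
      show "AE t in M. (\<lambda>n. Q (X n) t) \<longlonglongrightarrow> deriv (\<lambda>z. f z t) z0"
        using lim by auto
      show "AE t in M. norm (Q (X n) t) \<le> 2 / r * g t" for n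
        using Qbound X by auto
    qed (rule Qmeas)
    moreover have "\<forall>\<^sub>F n in sequentially. (\<integral>t. Q (X n) t \<partial>M) = (?F (X n) - ?F z0) / (X n - z0)"
      using Xev
    proof eventually_elim
      case (elim n)
      hence "X n \<in> ball z0 r" using r by auto
      from int[OF this] int[OF z0] elim show ?case
        by (simp add: Q_def)
    qed
    ultimately show "(\<lambda>n. (?F (X n) - ?F z0) / (X n - z0)) \<longlonglongrightarrow> (\<integral>t. deriv (\<lambda>z. f z t) z0 \<partial>M)"
      by (rule Lim_transform_eventually)
  qed
  thus ?thesis
    by (simp add: has_field_derivative_iff)
qed

lemma integrable_exp_minus_abs:
  fixes c :: real
  assumes c: "c > 0"
  shows "integrable lborel (\<lambda>u::real. exp (- c * \<bar>u\<bar>))"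
proof -
  have "(\<lambda>u. exp (- c * u)) integrable_on {0..}"
    using has_integral_exp_minus_to_infinity[OF c, of 0] by (auto simp: integrable_on_def)
  hence "(\<lambda>u. exp (- c * u)) absolutely_integrable_on {0..}"
    by (subst absolutely_integrable_on_iff_nonneg) auto
  hence 1: "integrable lborel (\<lambda>u. indicator {0..} u *\<^sub>R exp (- c * u))"
    unfolding set_integrable_def by (subst (asm) integrable_completion) auto
  from lborel_integrable_real_affine[OF this, of "-1" 0]
  have 2: "integrable lborel (\<lambda>u. indicator {0..} (-u) *\<^sub>R exp (c * u))" by simp
  show ?thesis
    by (rule Bochner_Integration.integrable_bound[OF Bochner_Integration.integrable_add[OF 1 2]])
       (auto intro!: AE_I2 simp: indicator_def abs_if)
qed

text \<open>
  Growth like \<open>e^(\<beta>u)\<close> on the right and \<open>e^(\<gamma>u)\<close> on the left gives convergence in the strip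
  \<open>\<beta> < Re s < \<gamma>\<close>: on a ball of radius \<open>c\<close> around \<open>s\<close> the integrand is dominated by a multiple of \<open>exp (-c\<bar>u\<bar>)\<close>.
  Functions supported on a half-line are covered as well, with an arbitrary exponent on the other side.
\<close>
lemma
  fixes h :: "real \<Rightarrow> complex"
  assumes h: "h \<in> borel_measurable borel"
    and right: "\<And>u. u \<ge> 0 \<Longrightarrow> norm (h u) \<le> C * exp (\<beta> * u)"
    and left: "\<And>u. u < 0 \<Longrightarrow> norm (h u) \<le> D * exp (\<gamma> * u)"
    and s: "\<beta> < Re s" "Re s < \<gamma>"
  shows integrable_laplace: "integrable lborel (\<lambda>u. exp (- s * of_real u) * h u)"
    and has_field_derivative_laplace:
      "((\<lambda>s. \<integral>u. exp (- s * of_real u) * h u \<partial>lborel) has_field_derivative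
        (\<integral>u. exp (- s * of_real u) * (- of_real u * h u) \<partial>lborel)) (at s)"
proof -
  \<comment> \<open>half the distance from \<open>s\<close> to the boundary of the strip\<close>
  define c where "c = min (Re s - \<beta>) (\<gamma> - Re s) / 2"
  have c: "c > 0" "Re s - \<beta> \<ge> 2 * c" "\<gamma> - Re s \<ge> 2 * c" using s by (auto simp: c_def)
  define B where "B = max C D"
  have C0: "0 \<le> B" using order_trans[OF norm_ge_zero right[of 0]] by (simp add: B_def le_max_iff_disj)
  have bnd: "norm (exp (- z * of_real u) * h u) \<le> B * exp (- c * \<bar>u\<bar>)" if z: "z \<in> ball s c" for z u
  proof -
    have "\<bar>Re (z - s)\<bar> < c"
      using z abs_Re_le_cmod[of "z - s"] by (simp add: dist_norm norm_minus_commute)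
    hence z': "Re z - \<beta> \<ge> c" "\<gamma> - Re z \<ge> c" using c by auto
    show ?thesis
    proof (cases "u \<ge> 0")
      case True
      have "norm (exp (- z * of_real u) * h u) \<le> exp (- Re z * u) * (B * exp (\<beta> * u))"
        unfolding norm_mult using right[OF True]
        by (intro mult_mono) (auto intro: order_trans[OF _ mult_right_mono] simp: B_def)
      also have "\<dots> = B * exp (- (Re z - \<beta>) * u)" by (simp add: exp_diff algebra_simps flip: exp_add)
      also have "\<dots> \<le> B * exp (- c * u)"
        using mult_right_mono[OF z'(1) True]
        by (intro mult_left_mono C0) (simp add: algebra_simps)
      finally show ?thesis using True by simp
    next
      case False
      hence u: "u < 0" by simp
      have "norm (exp (- z * of_real u) * h u) \<le> exp (- Re z * u) * (B * exp (\<gamma> * u))"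
        unfolding norm_mult using left[OF u]
        by (intro mult_mono) (auto intro: order_trans[OF _ mult_right_mono] simp: B_def)
      also have "\<dots> = B * exp ((\<gamma> - Re z) * u)" by (simp add: exp_diff algebra_simps flip: exp_add)
      also have "\<dots> \<le> B * exp (c * u)"
        using mult_right_mono_neg[OF z'(2) less_imp_le[OF u]]
        by (intro mult_left_mono C0) (simp add: algebra_simps)
      finally show ?thesis using u by simp
    qed
  qed
  have meas: "(\<lambda>u. exp (- z * of_real u) * h u) \<in> borel_measurable lborel" for z
    using h by simp
  have int: "integrable lborel (\<lambda>u::real. B * exp (- c * \<bar>u\<bar>))"
    using integrable_exp_minus_abs[OF c(1)] by (rule integrable_mult_right)
  show "integrable lborel (\<lambda>u. exp (- s * of_real u) * h u)"
    by (rule Bochner_Integration.integrable_bound[OF int meas])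
       (use bnd[of s] c C0 in \<open>auto intro!: AE_I2 simp: abs_mult\<close>)
  have "((\<lambda>s. \<integral>u. exp (- s * of_real u) * h u \<partial>lborel) has_field_derivative
        (\<integral>u. deriv (\<lambda>s. exp (- s * of_real u) * h u) s \<partial>lborel)) (at s)"
    by (rule has_field_derivative_lebesgue_integral[OF c(1) _ meas int bnd])
       (auto intro!: holomorphic_intros)
  also have "(\<lambda>u. deriv (\<lambda>s. exp (- s * of_real u) * h u) s) =
             (\<lambda>u. exp (- s * of_real u) * (- of_real u * h u))"
    by (intro ext DERIV_imp_deriv) (auto intro!: derivative_eq_intros)
  finally show "((\<lambda>s. \<integral>u. exp (- s * of_real u) * h u \<partial>lborel) has_field_derivative
        (\<integral>u. exp (- s * of_real u) * (- of_real u * h u) \<partial>lborel)) (at s)" .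
qed

lemma power_le_exp_bound:
  fixes \<beta> :: real
  assumes "\<beta> > 0"
  shows "\<exists>C. \<forall>x\<ge>0. x ^ k \<le> C * exp (\<beta> * x)"
  using assms
proof (induction k arbitrary: \<beta>)
  case 0
  have "\<forall>x\<ge>0. x ^ 0 \<le> 1 * exp (\<beta> * x)" using 0 by simp
  thus ?case by blast
next
  case (Suc k)
  from Suc.IH[of "\<beta>/2"] Suc.prems obtain C where C: "\<And>x. x \<ge> 0 \<Longrightarrow> x ^ k \<le> C * exp (\<beta>/2 * x)" by auto
  have "x ^ Suc k \<le> (2/\<beta> * C) * exp (\<beta> * x)" if x: "x \<ge> 0" for x
  proof -
    have "x \<le> 2/\<beta> * exp (\<beta>/2 * x)"
      using exp_ge_add_one_self[of "\<beta>/2*x"] Suc.prems by (simp add: field_simps)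
    hence "x * x ^ k \<le> (2/\<beta> * exp (\<beta>/2 * x)) * (C * exp (\<beta>/2 * x))"
      using C[OF x] x Suc.prems by (intro mult_mono) auto
    also have "\<dots> = (2/\<beta> * C) * exp (\<beta> * x)" by (simp flip: exp_add)
    finally show ?thesis by simp
  qed
  thus ?case by blast
qed

section \<open>Powers of the logarithm along a ray\<close>

text \<open>
  At \<open>z = exp (u + \<i>\<psi>)\<close> this is \<open>(ln z)^k\<close>, cut off at \<open>\<bar>z\<bar> = 1\<close>.
\<close>
definition ray_power :: "real \<Rightarrow> nat \<Rightarrow> real \<Rightarrow> complex" where
  "ray_power \<psi> k u = indicator {0..} u * (of_real u + \<i> * of_real \<psi>) ^ k"

lemma ray_power_measurable [measurable]: "ray_power \<psi> k \<in> borel_measurable borel"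
  unfolding ray_power_def by measurable

lemma ray_power_bound:
  assumes "\<beta> > 0"
  obtains C where "\<And>u. u \<ge> 0 \<Longrightarrow> norm (ray_power \<psi> k u) \<le> C * exp (\<beta> * u)"
proof -
  obtain C where C: "\<And>x. x \<ge> 0 \<Longrightarrow> x ^ k \<le> C * exp (\<beta> * x)"
    using power_le_exp_bound[OF assms] by blast
  have "norm (ray_power \<psi> k u) \<le> (C * exp (\<beta> * \<bar>\<psi>\<bar>)) * exp (\<beta> * u)" if u: "u \<ge> 0" for u
  proof -
    have "norm (of_real u + \<i> * of_real \<psi>) \<le> u + \<bar>\<psi>\<bar>"
      using u norm_triangle_ineq[of "of_real u" "\<i> * of_real \<psi>"] by (simp add: norm_mult)
    hence "norm (of_real u + \<i> * of_real \<psi>) ^ k \<le> (u + \<bar>\<psi>\<bar>) ^ k"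
      by (intro power_mono) auto
    also have "\<dots> \<le> C * exp (\<beta> * (u + \<bar>\<psi>\<bar>))" using u by (intro C) auto
    finally show ?thesis using u by (simp add: ray_power_def norm_power exp_add algebra_simps)
  qed
  thus ?thesis by (rule that)
qed

lemma
  fixes y :: complex
  assumes y: "Re y > 0"
  shows integrable_ray_power:
      "integrable lborel (\<lambda>u. exp (- y * of_real u) * ray_power \<psi> k u)" (is ?I)
    and has_field_derivative_laplace_ray_power:
      "((\<lambda>y. exp (- y * (\<i> * of_real \<psi>)) * (\<integral>u. exp (- y * of_real u) * ray_power \<psi> k u \<partial>lborel))
        has_field_derivative
        - (exp (- y * (\<i> * of_real \<psi>)) * (\<integral>u. exp (- y * of_real u) * ray_power \<psi> (Suc k) u \<partial>lborel)))
        (at y)" (is ?D)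
proof -
  have b: "Re y / 2 > 0" using y by simp
  have left: "norm (ray_power \<psi> k u) \<le> 0 * exp ((Re y + 1) * u)" if "u < 0" for u k
    using that by (simp add: ray_power_def)
  have *: "Re y / 2 < Re y" "Re y < Re y + 1" using y by auto
  obtain C where C: "\<And>u. u \<ge> 0 \<Longrightarrow> norm (ray_power \<psi> k u) \<le> C * exp (Re y / 2 * u)"
    using ray_power_bound[OF b] by blast
  show I: ?I by (rule integrable_laplace[OF _ C left *]) auto
  obtain C' where C': "\<And>u. u \<ge> 0 \<Longrightarrow> norm (ray_power \<psi> (Suc k) u) \<le> C' * exp (Re y / 2 * u)"
    using ray_power_bound[OF b] by blast
  have I': "integrable lborel (\<lambda>u. exp (- y * of_real u) * ray_power \<psi> (Suc k) u)"
    by (rule integrable_laplace[OF _ C' left *]) auto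
  let ?L = "\<lambda>y. \<integral>u. exp (- y * of_real u) * ray_power \<psi> k u \<partial>lborel"
  have D: "(?L has_field_derivative
          (\<integral>u. exp (- y * of_real u) * (- of_real u * ray_power \<psi> k u) \<partial>lborel)) (at y)"
    by (rule has_field_derivative_laplace[OF _ C left *]) auto
  have "(\<lambda>u. exp (- y * of_real u) * (- of_real u * ray_power \<psi> k u)) =
        (\<lambda>u. \<i> * of_real \<psi> * (exp (- y * of_real u) * ray_power \<psi> k u) -
              exp (- y * of_real u) * ray_power \<psi> (Suc k) u)"
    by (auto simp: ray_power_def algebra_simps)
  hence "(\<integral>u. exp (- y * of_real u) * (- of_real u * ray_power \<psi> k u) \<partial>lborel) =
        \<i> * of_real \<psi> * ?L y - (\<integral>u. exp (- y * of_real u) * ray_power \<psi> (Suc k) u \<partial>lborel)"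
    using I I' by simp
  with D have D': "(?L has_field_derivative
       (\<i> * of_real \<psi> * ?L y - (\<integral>u. exp (- y * of_real u) * ray_power \<psi> (Suc k) u \<partial>lborel))) (at y)"
    by simp
  show ?D
    by (rule derivative_eq_intros D' refl | simp)+ (simp add: algebra_simps)
qed

lemma laplace_ray_power_0:
  fixes y :: complex
  assumes y: "Re y > 0"
  shows "(\<integral>u. exp (- y * of_real u) * ray_power \<psi> 0 u \<partial>lborel) = 1 / y"
proof -
  have [simp]: "y \<noteq> 0" using y by auto
  have zero_le_infty: "(0::ereal) \<le> \<infinity>" by simp
  have eq: "(\<lambda>x. indicator (einterval 0 \<infinity>) x *\<^sub>R exp (- y * of_real x)) =
    (\<lambda>x. if x = 0 then 0 else exp (- y * of_real x) * ray_power \<psi> 0 x)"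
    by (auto simp: fun_eq_iff ray_power_def indicator_def einterval_def)
  have ae: "AE x in lborel. (if x = 0 then 0 else exp (- y * of_real x) * ray_power \<psi> 0 x) =
               exp (- y * of_real x) * ray_power \<psi> 0 x"
    using AE_lborel_singleton[of 0] by eventually_elim auto
  have int: "set_integrable lborel (einterval 0 \<infinity>) (\<lambda>x. exp (- y * of_real x))"
    unfolding set_integrable_def eq
    by (subst integrable_cong_AE[OF _ _ ae]) (use integrable_ray_power[OF y] in auto)
  have lim: "((\<lambda>x. exp (- y * of_real x)) \<longlongrightarrow> 0) at_top"
  proof (rule tendsto_norm_zero_cancel)
    have "((\<lambda>x. exp (- Re y * x)) \<longlongrightarrow> 0) at_top"
      using y by real_asymp
    thus "((\<lambda>x::real. norm (exp (- y * of_real x))) \<longlongrightarrow> 0) at_top" by simp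
  qed
  have "(LBINT x=0..\<infinity>. exp (- y * of_real x)) = 0 - (- exp (- y * of_real 0) / y)"
  proof (rule interval_integral_FTC_integrable[where F = "\<lambda>x. - exp (- y * of_real x) / y"])
    show "((\<lambda>x. - exp (- y * of_real x) / y) has_vector_derivative exp (- y * of_real x)) (at x)" for x
      by (rule has_vector_derivative_real_field) (auto intro!: derivative_eq_intros)
    show "(((\<lambda>x. - exp (- y * complex_of_real x) / y) \<circ> real_of_ereal) \<longlongrightarrow> 0) (at_left \<infinity>)"
      by (subst ereal_tendsto_simps1) (use tendsto_divide[OF tendsto_minus[OF lim] tendsto_const[of y]] in simp)
    have "((\<lambda>x. - exp (- y * complex_of_real x) / y) \<longlongrightarrow> - exp (- y * complex_of_real 0) / y) (at_right 0)"
      by (intro tendsto_intros) auto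
    thus "(((\<lambda>x. - exp (- y * complex_of_real x) / y) \<circ> real_of_ereal) \<longlongrightarrow> - exp (- y * complex_of_real 0) / y) (at_right 0)"
      by (simp add: zero_ereal_def ereal_tendsto_simps1)
  qed (use int in \<open>auto intro!: continuous_intros\<close>)
  hence "1 / y = (LBINT x=0..\<infinity>. exp (- y * of_real x))" by simp
  also have "\<dots> = (\<integral>u. exp (- y * of_real u) * ray_power \<psi> 0 u \<partial>lborel)"
    unfolding interval_lebesgue_integral_le_eq[OF zero_le_infty] set_lebesgue_integral_def eq
    by (rule integral_cong_AE[OF _ _ ae]) auto
  finally show ?thesis by (rule sym)
qed

text \<open>
  The transform of \<open>(ln z)^k\<close> is \<open>k! / y^(k+1)\<close> up to an entire function. For \<open>k = 0\<close> it is
  \<open>e^(-\<i>\<psi>y) / y\<close>, and raising \<open>k\<close> by one amounts to applying \<open>-d/dy\<close>, which keeps the error entire. Only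
  the principal part matters below, so the entire part, essentially an incomplete Gamma function, is left implicit.
\<close>
lemma laplace_ray_power:
  "\<exists>E. E holomorphic_on UNIV \<and>
     (\<forall>y. Re y > 0 \<longrightarrow>
        exp (- y * (\<i> * of_real \<psi>)) * (\<integral>u. exp (- y * of_real u) * ray_power \<psi> k u \<partial>lborel) =
        fact k / y ^ Suc k + E y)"
proof (induction k)
  case 0
  define g where "g = (\<lambda>y. exp (- y * (\<i> * complex_of_real \<psi>)) - 1)"
  define E where "E = (\<lambda>y. if y = 0 then deriv g 0 else g y / y)"
  have "E holomorphic_on UNIV"
    by (rule pole_theorem_0[of g _ 0]) (auto simp: E_def g_def intro!: holomorphic_intros)
  moreover have "exp (- y * (\<i> * of_real \<psi>)) * (\<integral>u. exp (- y * of_real u) * ray_power \<psi> 0 u \<partial>lborel) =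
        fact 0 / y ^ Suc 0 + E y" if "Re y > 0" for y
  proof -
    have "y \<noteq> 0" using that by auto
    thus ?thesis unfolding laplace_ray_power_0[OF that] by (simp add: E_def g_def field_simps)
  qed
  ultimately show ?case by blast
next
  case (Suc k)
  let ?G = "\<lambda>k y. exp (- y * (\<i> * of_real \<psi>)) * (\<integral>u. exp (- y * of_real u) * ray_power \<psi> k u \<partial>lborel)"
  obtain E where E: "E holomorphic_on UNIV" "\<And>y. Re y > 0 \<Longrightarrow> ?G k y = fact k / y ^ Suc k + E y"
    using Suc.IH by blast
  have "(\<lambda>y. - deriv E y) holomorphic_on UNIV"
    using E(1) by (auto intro!: holomorphic_intros)
  moreover have "?G (Suc k) y = fact (Suc k) / y ^ Suc (Suc k) + - deriv E y" if y: "Re y > 0" for y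
  proof -
    have [simp]: "y \<noteq> 0" using y by auto
    have E': "(E has_field_derivative deriv E y) (at y)"
      using E(1) by (auto intro: holomorphic_derivI)
    have d1: "((\<lambda>y. fact k / y ^ Suc k + E y) has_field_derivative
             - (fact (Suc k) / y ^ Suc (Suc k)) + deriv E y) (at y)"
      by (rule derivative_eq_intros E' refl | simp)+
    have d2: "((\<lambda>y. fact k / y ^ Suc k + E y) has_field_derivative - ?G (Suc k) y) (at y)"
      by (rule has_field_derivative_transform_within_open[OF has_field_derivative_laplace_ray_power[OF y],
              where S = "{y. Re y > 0}"])
         (use y E(2) in \<open>auto simp: open_halfspace_Re_gt\<close>)
    from DERIV_unique[OF d1 d2] show ?thesis by (simp add: algebra_simps)
  qed
  ultimately show ?case by blast
qed

text \<open>
  If \<open>h\<close> is, to the right of 0, a finite sum of terms \<open>q z^\<beta> (ln z)^k\<close> plus an error \<open>O(e^(\<eta>u))\<close>, then its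
  transform extends meromorphically to \<open>\<eta> < Re s < \<gamma>\<close>, with the principal parts shown. The terms are subtracted
  only for \<open>u \<ge> 0\<close>; the rest is small enough on both sides to have a holomorphic transform in the large strip.
\<close>
lemma laplace_continuation:
  fixes h :: "real \<Rightarrow> complex" and q :: "'i \<Rightarrow> complex" and \<beta> :: "'i \<Rightarrow> real" and k :: "'i \<Rightarrow> nat"
  assumes h [measurable]: "h \<in> borel_measurable borel"
    and I: "finite I" "\<And>i. i \<in> I \<Longrightarrow> \<beta> i \<le> \<alpha>" and \<eta>: "\<eta> \<le> \<alpha>"
    and left: "\<And>u. u < 0 \<Longrightarrow> norm (h u) \<le> C * exp (\<gamma> * u)"
    and right: "\<And>u. u \<ge> 0 \<Longrightarrow>
       norm (h u - (\<Sum>i\<in>I. q i * exp (of_real (\<beta> i) * (of_real u + \<i> * of_real \<psi>))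
                        * (of_real u + \<i> * of_real \<psi>) ^ k i)) \<le> D * exp (\<eta> * u)"
  obtains H where "H holomorphic_on {s. \<eta> < Re s \<and> Re s < \<gamma>}"
    and "\<And>s. \<alpha> < Re s \<Longrightarrow> Re s < \<gamma> \<Longrightarrow>
        exp (- s * (\<i> * of_real \<psi>)) * (\<integral>u. exp (- s * of_real u) * h u \<partial>lborel) =
        H s + (\<Sum>i\<in>I. q i * (fact (k i) / (s - of_real (\<beta> i)) ^ Suc (k i)))"
proof -
  define T where "T = (\<lambda>i u. exp (of_real (\<beta> i) * (of_real u + \<i> * of_real \<psi>)) * ray_power \<psi> (k i) u)"
  define h0 where "h0 = (\<lambda>u. h u - (\<Sum>i\<in>I. q i * T i u))"
  have T_meas [measurable]: "T i \<in> borel_measurable borel" for i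
    unfolding T_def by measurable
  have h0_meas: "h0 \<in> borel_measurable borel" unfolding h0_def by measurable
  have h0_left: "norm (h0 u) \<le> C * exp (\<gamma> * u)" if "u < 0" for u
    using left[OF that] that by (simp add: h0_def T_def ray_power_def)
  have h0_right: "norm (h0 u) \<le> D * exp (\<eta> * u)" if "u \<ge> 0" for u
    using right[OF that] that by (simp add: h0_def T_def ray_power_def mult.assoc)
  define A where "A = (\<lambda>s. \<integral>u. exp (- s * of_real u) * h0 u \<partial>lborel)"
  have A: "A holomorphic_on {s. \<eta> < Re s \<and> Re s < \<gamma>}"
    unfolding A_def
  proof (rule holomorphic_onI, rule field_differentiable_at_within)
    fix s assume "s \<in> {s. \<eta> < Re s \<and> Re s < \<gamma>}"
    hence s: "\<eta> < Re s" "Re s < \<gamma>" by auto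
    show "(\<lambda>s. \<integral>u. exp (- s * of_real u) * h0 u \<partial>lborel) field_differentiable at s"
      unfolding field_differentiable_def
      by (rule exI, rule has_field_derivative_laplace[OF h0_meas h0_right h0_left s])
  qed
  obtain E where E: "\<And>k. E k holomorphic_on UNIV"
      "\<And>k y. Re y > 0 \<Longrightarrow>
        exp (- y * (\<i> * of_real \<psi>)) * (\<integral>u. exp (- y * of_real u) * ray_power \<psi> k u \<partial>lborel) =
        fact k / y ^ Suc k + E k y"
    using laplace_ray_power[of \<psi>] by metis
  define H where "H = (\<lambda>s. exp (- s * (\<i> * of_real \<psi>)) * A s + (\<Sum>i\<in>I. q i * E (k i) (s - of_real (\<beta> i))))"
  have E': "(\<lambda>s. E k (s - b)) holomorphic_on S" for k b S
    by (rule holomorphic_on_compose[of "\<lambda>s. s - b" S "E k", unfolded o_def])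
       (auto intro!: holomorphic_intros intro: holomorphic_on_subset[OF E(1)])
  show ?thesis
  proof (rule that)
    show "H holomorphic_on {s. \<eta> < Re s \<and> Re s < \<gamma>}"
      unfolding H_def by (intro holomorphic_intros A E')
  next
    fix s assume s: "\<alpha> < Re s" "Re s < \<gamma>"
    have shift: "exp (- s * of_real u) * T i u =
       exp (s * (\<i> * of_real \<psi>)) * (exp (- (s - of_real (\<beta> i)) * (\<i> * of_real \<psi>)) *
          (exp (- (s - of_real (\<beta> i)) * of_real u) * ray_power \<psi> (k i) u))" for i u
      unfolding T_def by (simp add: mult.assoc[symmetric] flip: exp_add) (simp add: algebra_simps)
    have Re: "Re (s - of_real (\<beta> i)) > 0" if "i \<in> I" for i using I(2)[OF that] s by simp
    have int0: "integrable lborel (\<lambda>u. exp (- s * of_real u) * h0 u)"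
      by (rule integrable_laplace[OF h0_meas h0_right h0_left]) (use s \<eta> in auto)
    have intT: "integrable lborel (\<lambda>u. exp (- s * of_real u) * T i u)" if "i \<in> I" for i
      unfolding shift using integrable_ray_power[OF Re[OF that]] by simp
    have valT: "exp (- s * (\<i> * of_real \<psi>)) * (\<integral>u. exp (- s * of_real u) * T i u \<partial>lborel) =
      fact (k i) / (s - of_real (\<beta> i)) ^ Suc (k i) + E (k i) (s - of_real (\<beta> i))" if "i \<in> I" for i
      unfolding shift integral_mult_right_zero E(2)[OF Re[OF that], symmetric]
      by (simp add: mult.assoc[symmetric] flip: exp_add)
    have "(\<lambda>u. exp (- s * of_real u) * h u) =
          (\<lambda>u. exp (- s * of_real u) * h0 u + (\<Sum>i\<in>I. q i * (exp (- s * of_real u) * T i u)))"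
      by (simp add: h0_def algebra_simps sum_distrib_left)
    hence "(\<integral>u. exp (- s * of_real u) * h u \<partial>lborel) =
        A s + (\<Sum>i\<in>I. q i * (\<integral>u. exp (- s * of_real u) * T i u \<partial>lborel))"
      using int0 intT by (simp add: A_def)
    hence "exp (- s * (\<i> * of_real \<psi>)) * (\<integral>u. exp (- s * of_real u) * h u \<partial>lborel) =
       exp (- s * (\<i> * of_real \<psi>)) * A s +
        (\<Sum>i\<in>I. q i * (exp (- s * (\<i> * of_real \<psi>)) * (\<integral>u. exp (- s * of_real u) * T i u \<partial>lborel)))"
      by (simp add: algebra_simps sum_distrib_left)
    also have "\<dots> = H s + (\<Sum>i\<in>I. q i * (fact (k i) / (s - of_real (\<beta> i)) ^ Suc (k i)))"
      using valT by (simp add: H_def algebra_simps sum.distrib)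
    finally show "exp (- s * (\<i> * of_real \<psi>)) * (\<integral>u. exp (- s * of_real u) * h u \<partial>lborel) =
        H s + (\<Sum>i\<in>I. q i * (fact (k i) / (s - of_real (\<beta> i)) ^ Suc (k i)))" .
  qed
qed

section \<open>The transform of a single Weierstrass factor\<close>

text \<open>
  The logarithm of the Weierstrass factor of genus \<open>p\<close> at \<open>-w\<close>. With this sign its domain is the
  plane slit along \<open>w \<le> -1\<close>, which contains \<open>exp v\<close> for all \<open>v\<close> with \<open>\<bar>Im v\<bar> < \<pi>\<close>.
\<close>
definition genus_log :: "nat \<Rightarrow> complex \<Rightarrow> complex" where
  "genus_log p w = Ln (1 + w) + (\<Sum>j=1..p. (- w) ^ j / of_nat j)"

lemma exp_genus_log:
  assumes "1 + w \<noteq> 0"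
  shows "exp (genus_log p w) = weierstrass_factor p (- w)"
  using assms by (simp add: genus_log_def weierstrass_factor_def exp_add)

text \<open>
  The polynomial part of the derivative is a geometric sum; it cancels all but the last term of \<open>1/(1 + w)\<close>.
\<close>
lemma has_field_derivative_genus_log:
  assumes w: "1 + w \<notin> \<real>\<^sub>\<le>\<^sub>0"
  shows "(genus_log p has_field_derivative (- w) ^ p / (1 + w)) (at w)"
proof -
  have nz: "1 + w \<noteq> 0" using w by auto
  have eq: "(\<Sum>j=1..p. - ((- w) ^ (j - 1))) = - (\<Sum>i<p. (- w) ^ i)"
    by (simp add: sum_negf sum.atLeast1_atMost_eq)
  have gs: "(1 + w) * (\<Sum>i<p. (- w) ^ i) = 1 - (- w) ^ p"
    using one_diff_power_eq[of "- w" p] by simp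
  have sum': "((\<lambda>w. \<Sum>j=1..p. (- w) ^ j / of_nat j) has_field_derivative
          (\<Sum>j=1..p. - ((- w) ^ (j - 1)))) (at w)"
  proof (rule DERIV_sum)
    fix j assume "j \<in> {1..p}"
    hence [simp]: "j > 0" by simp
    show "((\<lambda>w. (- w) ^ j / of_nat j) has_field_derivative - ((- w) ^ (j - 1))) (at w)"
      by (rule derivative_eq_intros refl | simp)+
  qed
  have "(genus_log p has_field_derivative (1 / (1 + w) + - (\<Sum>i<p. (- w) ^ i))) (at w)"
    unfolding genus_log_def eq[symmetric]
    by (rule derivative_eq_intros sum' refl w | simp add: inverse_eq_divide)+
  also have "1 / (1 + w) + - (\<Sum>i<p. (- w) ^ i) = (- w) ^ p / (1 + w)"
    using nz gs by (simp add: field_simps)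
  finally show ?thesis .
qed

lemma one_plus_exp_slit:
  assumes "\<bar>Im v\<bar> < pi"
  shows "1 + exp v \<notin> \<real>\<^sub>\<le>\<^sub>0"
proof
  assume *: "1 + exp v \<in> \<real>\<^sub>\<le>\<^sub>0"
  hence "sin (Im v) = 0" by (auto simp: complex_nonpos_Reals_iff Im_exp)
  with assms have "Im v = 0" using sin_eq_0_pi[of "Im v"] by auto
  hence "Re (1 + exp v) > 0" by (simp add: Re_exp add_pos_pos)
  with * show False by (auto simp: complex_nonpos_Reals_iff)
qed

text \<open>
  With \<open>r = \<bar>exp v\<bar>\<close> and \<open>k = cos \<epsilon>\<close>, the square of the left-hand side is at least \<open>1 - 2rk + r\<^sup>2\<close>, and
  subtracting the square of the right-hand side leaves \<open>(1 + k)/2 * (1 - r)\<^sup>2\<close>.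
\<close>
lemma norm_one_plus_exp_ge:
  assumes \<epsilon>: "0 < \<epsilon>" "\<epsilon> \<le> pi" and v: "\<bar>Im v\<bar> \<le> pi - \<epsilon>"
  shows "norm (1 + exp v) \<ge> sqrt ((1 - cos \<epsilon>) / 2) * (1 + exp (Re v))"
proof (rule power2_le_imp_le)
  define r where "r = exp (Re v)"
  define k where "k = cos \<epsilon>"
  have r: "r > 0" by (simp add: r_def)
  have k: "-1 \<le> k" "k \<le> 1" by (auto simp: k_def)
  have "cos (pi - \<epsilon>) \<le> cos \<bar>Im v\<bar>"
    using \<epsilon> v by (intro cos_monotone_0_pi_le) auto
  hence "- k \<le> cos (Im v)" by (simp add: k_def)
  hence 1: "r * - k \<le> r * cos (Im v)" using r by (intro mult_left_mono) auto
  have 2: "0 \<le> (1 + k) / 2 * (1 - r)^2" using k by auto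
  have "(norm (1 + exp v))\<^sup>2 = (1 + r * cos (Im v))\<^sup>2 + (r * sin (Im v))\<^sup>2"
    by (simp add: cmod_power2 Re_exp Im_exp r_def)
  also have "\<dots> = 1 + 2 * (r * cos (Im v)) + r\<^sup>2"
    unfolding power_mult_distrib sin_squared_eq by (simp add: power2_eq_square algebra_simps)
  also have "\<dots> \<ge> (1 - k) / 2 * (1 + r)\<^sup>2"
    using 1 2 by (simp add: power2_eq_square field_simps)
  also have "(1 - k) / 2 * (1 + r)\<^sup>2 = (sqrt ((1 - cos \<epsilon>) / 2) * (1 + exp (Re v)))\<^sup>2"
    using k by (simp add: power_mult_distrib k_def r_def)
  finally show "(sqrt ((1 - cos \<epsilon>) / 2) * (1 + exp (Re v)))\<^sup>2 \<le> (norm (1 + exp v))\<^sup>2" .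
qed simp

text \<open>
  This one bound, with \<open>\<beta>\<close> free in \<open>[p, p + 1]\<close>, serves both at the origin (\<open>\<beta> = p + 1\<close>) and at infinity
  (smaller \<open>\<beta>\<close>). It follows by integrating the derivative \<open>\<plusminus>w^p/(1 + w)\<close> along the segment from 0, using
  \<open>y powr (p + 1 - \<beta>) \<le> 1 + y\<close> in the denominator.
\<close>
lemma norm_genus_log_le:
  assumes \<epsilon>: "0 < \<epsilon>" "\<epsilon> \<le> pi" and v: "\<bar>Im v\<bar> \<le> pi - \<epsilon>"
    and \<beta>: "0 < \<beta>" "real p \<le> \<beta>" "\<beta> \<le> real p + 1"
  shows "norm (genus_log p (exp v)) \<le> exp (\<beta> * Re v) / (\<beta> * sqrt ((1 - cos \<epsilon>) / 2))"
proof -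
  define c where "c = sqrt ((1 - cos \<epsilon>) / 2)"
  have "cos \<epsilon> < cos 0" using \<epsilon> by (intro cos_monotone_0_pi) auto
  hence c: "c > 0" by (simp add: c_def)
  define r where "r = exp (Re v)"
  have r: "r > 0" "norm (exp v) = r" by (simp_all add: r_def)
  define f where "f = (\<lambda>x::real. genus_log p (of_real x * exp v))"
  define f' where "f' = (\<lambda>x::real. exp v * ((- (of_real x * exp v)) ^ p / (1 + of_real x * exp v)))"
  have slit: "1 + of_real x * exp v \<notin> \<real>\<^sub>\<le>\<^sub>0" if "x \<ge> 0" for x :: real
  proof (cases "x = 0")
    case False
    with that have "of_real x * exp v = exp (v + of_real (ln x))" by (simp add: exp_add exp_of_real)
    thus ?thesis using one_plus_exp_slit[of "v + of_real (ln x)"] v \<epsilon> by simp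
  qed simp
  have deriv: "(f has_vector_derivative f' x) (at x)" if "x \<ge> 0" for x
  proof -
    have "((\<lambda>x. genus_log p (x * exp v)) has_field_derivative
            (- (of_real x * exp v)) ^ p / (1 + of_real x * exp v) * exp v) (at (of_real x))"
      by (rule DERIV_chain2[where f = "genus_log p" and g = "\<lambda>x. x * exp v", OF has_field_derivative_genus_log[OF slit[OF that]]])
         (auto intro!: derivative_eq_intros)
    from has_vector_derivative_real_field[OF this] show ?thesis
      by (simp add: f_def f'_def mult.commute)
  qed
  define C where "C = r powr \<beta> / c"
  have "norm (f 1 - f 0) \<le> C / \<beta> * 1 powr \<beta> - C / \<beta> * 0 powr \<beta>"
  proof (rule differentiable_bound_general[where f' = f' and \<phi>' = "\<lambda>x. C * x powr (\<beta> - 1)"])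
    show "continuous_on {0..1} f"
      by (intro continuous_at_imp_continuous_on ballI has_vector_derivative_continuous[OF deriv]) auto
    show "continuous_on {0..1} (\<lambda>x. C / \<beta> * x powr \<beta>)"
      using \<beta> by (intro continuous_intros continuous_on_powr') auto
  next
    fix x :: real assume x: "0 < x" "x < 1"
    show "(f has_vector_derivative f' x) (at x)" by (rule deriv) (use x in auto)
    show "((\<lambda>x. C / \<beta> * x powr \<beta>) has_vector_derivative C * x powr (\<beta> - 1)) (at x)"
      unfolding has_real_derivative_iff_has_vector_derivative[symmetric]
      by (rule derivative_eq_intros refl | use x \<beta> in simp)+
    have e: "of_real x * exp v = exp (v + of_real (ln x))"
      using x by (simp add: exp_add exp_of_real)
    have lower: "norm (1 + of_real x * exp v) \<ge> c * (1 + x * r)"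
      using norm_one_plus_exp_ge[OF \<epsilon>, of "v + of_real (ln x)"] v x
      unfolding e by (simp add: c_def r_def exp_add mult.commute)
    have xr: "x * r > 0" using x r by simp
    have "(x * r) powr (real p + 1 - \<beta>) \<le> 1 + x * r"
    proof (cases "x * r \<le> 1")
      case True
      hence "(x * r) powr (real p + 1 - \<beta>) \<le> 1" using xr \<beta> by (intro powr_le1) auto
      thus ?thesis using xr by linarith
    next
      case False
      hence "(x * r) powr (real p + 1 - \<beta>) \<le> (x * r) powr 1" using \<beta> by (intro powr_mono) auto
      thus ?thesis using xr by simp
    qed
    hence "c * (x * r) powr (real p + 1 - \<beta>) \<le> norm (1 + of_real x * exp v)"
      using c by (intro order_trans[OF _ lower] mult_left_mono) auto
    moreover have "0 < c * (x * r) powr (real p + 1 - \<beta>)" using c x r(1) by simp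
    ultimately have "r * (x * r) ^ p / norm (1 + of_real x * exp v) \<le>
        r * (x * r) ^ p / (c * (x * r) powr (real p + 1 - \<beta>))"
      using xr r(1) c by (intro divide_left_mono mult_pos_pos) auto
    also have "r * (x * r) ^ p / norm (1 + of_real x * exp v) = norm (f' x)"
      using x r(1) unfolding f'_def r(2)[symmetric] by (simp add: norm_mult norm_divide norm_power)
    finally have "norm (f' x) \<le> r * (x * r) ^ p / (c * (x * r) powr (real p + 1 - \<beta>))" .
    also have "\<dots> = C * x powr (\<beta> - 1)"
      using x r c xr unfolding C_def
      by (simp add: powr_realpow[symmetric] powr_diff powr_add powr_mult field_simps)
    finally show "norm (f' x) \<le> C * x powr (\<beta> - 1)" .
  qed auto
  also have "f 1 - f 0 = genus_log p (exp v)"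
    by (simp add: f_def genus_log_def power_0_left)
  finally show ?thesis using \<beta> by (simp add: C_def c_def r_def exp_powr_real mult.commute)
qed

lemma sin_pi_nonzero:
  fixes s :: complex
  assumes "real p < Re s" "Re s < real p + 1"
  shows "sin (of_real pi * s) \<noteq> 0"
proof
  assume "sin (of_real pi * s) = 0"
  then obtain n :: int where "of_real pi * s = of_real (n * pi)" by (auto simp: sin_eq_0)
  hence "s = of_real (real_of_int n)" by simp
  hence "Re s = real_of_int n" by simp
  with assms have "real p < real_of_int n" "real_of_int n < real p + 1" by auto
  hence "int p < n" "n < int p + 1" by linarith+
  thus False by linarith
qed

text \<open>
  The substitution \<open>t = e^u / (1 + e^u)\<close> turns the integral into \<open>Beta x (1 - x)\<close>, and Euler's reflection
  formula evaluates it.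
\<close>
lemma logistic_mellin_real:
  fixes x :: real
  assumes x: "0 < x" "x < 1"
  shows "(\<integral>u. exp (x * u) / (1 + exp u) \<partial>lborel) = pi / sin (pi * x)"
    and "integrable lborel (\<lambda>u. exp (x * u) / (1 + exp u))"
proof -
  have "integrable lborel (\<lambda>u::real. exp (- complex_of_real (-x) * of_real u) * (1 / (1 + exp (of_real u))))"
  \<comment> \<open>\<open>1 / (1 + e^u)\<close> is at most \<open>e^(-u)\<close> and at most 1, which allows transforms for \<open>-1 < Re s < 0\<close>, where \<open>s = -x\<close>\<close>
  proof (rule integrable_laplace[where \<beta> = "-1" and \<gamma> = 0 and C = 1 and D = 1])
    fix u :: real
    have e: "norm (1 / (1 + exp (complex_of_real u))) = 1 / (1 + exp u)"
    proof -
      have "1 + exp (complex_of_real u) = of_real (1 + exp u)" by (simp add: exp_of_real)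
      thus ?thesis by (simp add: norm_divide del: of_real_add)
    qed
    have "1 / (1 + exp u) \<le> 1 / exp u" by (intro divide_left_mono) (auto intro!: mult_pos_pos add_pos_pos)
    thus "norm (1 / (1 + exp (complex_of_real u))) \<le> 1 * exp (- 1 * u)"
      unfolding e by (simp add: exp_minus inverse_eq_divide)
    show "norm (1 / (1 + exp (complex_of_real u))) \<le> 1 * exp (0 * u)"
      unfolding e by (simp add: divide_le_eq add_pos_pos)
  qed (use x in auto)
  hence "integrable lborel (\<lambda>u::real. norm (exp (- complex_of_real (-x) * of_real u) * (1 / (1 + exp (of_real u)))))"
    by (rule integrable_norm)
  also have "(\<lambda>u::real. norm (exp (- complex_of_real (-x) * of_real u) * (1 / (1 + exp (of_real u))))) =
      (\<lambda>u. exp (x * u) / (1 + exp u))"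
  proof
    fix u :: real
    have "1 + exp (complex_of_real u) = of_real (1 + exp u)" by (simp add: exp_of_real)
    thus "norm (exp (- complex_of_real (-x) * of_real u) * (1 / (1 + exp (of_real u)))) = exp (x * u) / (1 + exp u)"
      by (simp add: norm_divide norm_mult del: of_real_add)
  qed
  finally show int: "integrable lborel (\<lambda>u. exp (x * u) / (1 + exp u))" .
  define f where "f = (\<lambda>t::real. t powr (x - 1) * (1 - t) powr ((1 - x) - 1))"
  define g where "g = (\<lambda>u::real. exp u / (1 + exp u))"
  define g' where "g' = (\<lambda>u::real. exp u / (1 + exp u)^2)"
  have pos [simp]: "1 + exp u > 0" "1 + exp u \<noteq> 0" for u :: real
    by (simp_all add: add_pos_pos pos_add_strict add_nonneg_eq_0_iff)
  have g01: "0 < g u" "g u < 1" "1 - g u = 1 / (1 + exp u)" for u by (simp_all add: g_def field_simps)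
  have fg: "f (g u) * g' u = exp (x * u) / (1 + exp u)" for u
  proof -
    have "f (g u) = exp ((x - 1) * u) / (1 + exp u) powr (x - 1) * (1 / (1 + exp u)) powr (- x)"
      unfolding f_def g01(3) by (simp add: g_def powr_divide exp_powr_real mult.commute)
    also have "\<dots> = exp ((x - 1) * u) * (1 + exp u)"
      by (simp add: powr_divide powr_diff powr_minus field_simps)
    finally have "f (g u) * g' u = exp ((x - 1) * u) * exp u / (1 + exp u)"
      by (simp add: g'_def power2_eq_square)
    also have "exp ((x - 1) * u) * exp u = exp (x * u)"
      by (simp add: algebra_simps flip: exp_add)
    finally show ?thesis .
  qed
  have einU: "einterval (-\<infinity>) \<infinity> = UNIV" by (auto simp: einterval_def)
  have sub: "(LBINT t=0..1. f t) = (LBINT u=-\<infinity>..\<infinity>. f (g u) * g' u)"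
  proof (rule interval_integral_substitution_nonneg(2))
    show "DERIV g u :> g' u" for u
      unfolding g_def g'_def
      by (rule derivative_eq_intros refl | simp)+ (simp add: power2_eq_square field_simps)
    show "isCont f (g u)" for u
      unfolding f_def using g01[of u] by (intro continuous_intros) auto
    show "isCont g' u" for u
      unfolding g'_def by (intro continuous_intros) simp
    show "0 \<le> f (g u)" for u by (simp add: f_def)
    show "0 \<le> g' u" for u by (simp add: g'_def)
    have "(g \<longlongrightarrow> 0) at_bot" unfolding g_def by real_asymp
    hence "((\<lambda>u. ereal (g u)) \<longlongrightarrow> ereal 0) at_bot" by (rule tendsto_ereal)
    thus "((ereal \<circ> g \<circ> real_of_ereal) \<longlongrightarrow> 0) (at_right (-\<infinity>))"
      unfolding ereal_tendsto_simps1 by (simp add: o_def zero_ereal_def)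
    have "(g \<longlongrightarrow> 1) at_top" unfolding g_def by real_asymp
    hence "((\<lambda>u. ereal (g u)) \<longlongrightarrow> ereal 1) at_top" by (rule tendsto_ereal)
    thus "((ereal \<circ> g \<circ> real_of_ereal) \<longlongrightarrow> 1) (at_left \<infinity>)"
      unfolding ereal_tendsto_simps1 by (simp add: o_def one_ereal_def)
    show "set_integrable lborel (einterval (-\<infinity>) \<infinity>) (\<lambda>u. f (g u) * g' u)"
      unfolding fg einU using int by (simp add: set_integrable_def)
  qed auto
  have "(\<integral>u. exp (x * u) / (1 + exp u) \<partial>lborel) = (LBINT t=0..1. f t)"
    unfolding sub fg by (simp add: interval_lebesgue_integral_def einU set_lebesgue_integral_def)
  also have "\<dots> = (LBINT t:{0..1}. f t)"
    using interval_integral_Icc[of 0 1 f] by (simp add: zero_ereal_def one_ereal_def)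
  also have "\<dots> = integral {0..1} f"
    unfolding f_def by (rule set_borel_integral_eq_integral(2)[OF integrable_Beta]) (use x in auto)
  also have "\<dots> = Beta x (1 - x)"
    unfolding f_def by (rule integral_unique[OF has_integral_Beta_real]) (use x in auto)
  also have "\<dots> = pi / sin (pi * x)"
  proof -
    have "complex_of_real (Beta x (1 - x)) = Gamma (of_real x) * Gamma (1 - of_real x)"
      using Gamma_complex_of_real[of x] Gamma_complex_of_real[of "1 - x"] by (simp add: Beta_def)
    also have "\<dots> = of_real (pi / sin (pi * x))"
      by (simp add: Gamma_reflection_complex sin_of_real flip: of_real_mult)
    finally show ?thesis by (simp only: of_real_eq_iff)
  qed
  finally show "(\<integral>u. exp (x * u) / (1 + exp u) \<partial>lborel) = pi / sin (pi * x)" .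
qed

lemma islimpt_of_real_image:
  fixes x :: real
  assumes "x islimpt S"
  shows "complex_of_real x islimpt of_real ` S"
  using assms unfolding islimpt_approachable by (auto simp: dist_of_real)

text \<open>
  Both sides are holomorphic in the strip and agree on the real segment \<open>(0, 1)\<close>.
\<close>
lemma logistic_mellin:
  fixes z :: complex
  assumes z: "0 < Re z" "Re z < 1"
  shows "(\<integral>u. exp (z * of_real u) / (1 + exp (of_real u)) \<partial>lborel) = of_real pi / sin (of_real pi * z)"
    and "integrable lborel (\<lambda>u. exp (z * of_real u) / (1 + exp (of_real u)))"
proof -
  define h where "h = (\<lambda>u::real. 1 / (1 + exp (complex_of_real u)))"
  have e: "norm (h u) = 1 / (1 + exp u)" for u
  proof -
    have "1 + exp (complex_of_real u) = of_real (1 + exp u)" by (simp add: exp_of_real)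
    thus ?thesis by (simp add: h_def norm_divide del: of_real_add)
  qed
  have right: "norm (h u) \<le> 1 * exp (- 1 * u)" for u
  proof -
    have "1 / (1 + exp u) \<le> 1 / exp u" by (intro divide_left_mono) (auto intro!: mult_pos_pos add_pos_pos)
    thus ?thesis unfolding e by (simp add: exp_minus inverse_eq_divide)
  qed
  have left: "norm (h u) \<le> 1 * exp (0 * u)" for u
    unfolding e by (simp add: divide_le_eq add_pos_pos)
  have meas: "h \<in> borel_measurable borel" unfolding h_def by measurable
  define J where "J = (\<lambda>z. \<integral>u. exp (- (- z) * of_real u) * h u \<partial>lborel)"
  let ?S = "{z. 0 < Re z \<and> Re z < 1}"
  have J_deriv: "\<exists>D. (J has_field_derivative D) (at z)" if "z \<in> ?S" for z
  proof -
    have z: "-1 < Re (- z)" "Re (- z) < 0" using that by auto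
    have "((\<lambda>s. - s) has_field_derivative -1) (at z)" by (auto intro!: derivative_eq_intros)
    from DERIV_chain2[where g = "\<lambda>s. - s", OF has_field_derivative_laplace[OF meas right left z] this]
    show ?thesis unfolding J_def by blast
  qed
  have openS: "open ?S"
    by (intro open_Collect_conj open_halfspace_Re_gt open_halfspace_Re_lt)
  have "?S = {z. Re z > 0} \<inter> {z. Re z < 1}" by auto
  hence "convex ?S" by (auto intro!: convex_Int convex_halfspace_Re_gt convex_halfspace_Re_lt)
  hence conS: "connected ?S" by (rule convex_connected)
  have "J z - of_real pi / sin (of_real pi * z) = 0"
  proof (rule analytic_continuation[where S = ?S and w = z and
        f = "\<lambda>z. J z - of_real pi / sin (of_real pi * z)" and U = "of_real ` {0<..<1::real}" and \<xi> = "1/2"])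
    show "(\<lambda>z. J z - of_real pi / sin (of_real pi * z)) holomorphic_on ?S"
    proof (intro holomorphic_intros)
      show "J holomorphic_on ?S"
        unfolding holomorphic_on_open[OF openS] using J_deriv by blast
      show "sin (of_real pi * z) \<noteq> 0" if "z \<in> ?S" for z
        by (rule sin_pi_nonzero[of 0]) (use that in auto)
    qed
    have "complex_of_real (1/2) islimpt of_real ` {0<..<1::real}"
      by (intro islimpt_of_real_image interior_limit_point) (simp add: interior_open)
    thus "1/2 islimpt complex_of_real ` {0<..<1::real}" by simp
  next
    fix w assume "w \<in> complex_of_real ` {0<..<1}"
    then obtain x where x: "w = of_real x" "0 < x" "x < 1" by auto
    have "J w = (\<integral>u. of_real (exp (x * u) / (1 + exp u)) \<partial>lborel)"
      unfolding J_def h_def x by (simp flip: exp_of_real)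
    also have "\<dots> = of_real (pi / sin (pi * x))"
      unfolding integral_complex_of_real logistic_mellin_real[OF x(2,3)] ..
    finally show "J w - of_real pi / sin (of_real pi * w) = 0"
      by (simp add: x sin_of_real flip: of_real_mult)
  qed (use z openS conS in auto)
  thus "(\<integral>u. exp (z * of_real u) / (1 + exp (of_real u)) \<partial>lborel) = of_real pi / sin (of_real pi * z)"
    by (simp add: J_def h_def)
  have "integrable lborel (\<lambda>u. exp (- (- z) * of_real u) * h u)"
    by (rule integrable_laplace[OF meas right left]) (use z in auto)
  thus "integrable lborel (\<lambda>u. exp (z * of_real u) / (1 + exp (of_real u)))"
    by (simp add: h_def)
qed

lemma genus_log_exp_measurable:
  assumes "\<bar>Im \<tau>\<bar> < pi"
  shows "(\<lambda>u. genus_log p (exp (of_real u + \<tau>))) \<in> borel_measurable borel"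
proof (rule borel_measurable_continuous_onI, rule continuous_at_imp_continuous_on, rule ballI)
  fix u :: real
  have "isCont (genus_log p) (exp (of_real u + \<tau>))"
    by (rule DERIV_isCont[OF has_field_derivative_genus_log[OF one_plus_exp_slit]]) (use assms in simp)
  thus "isCont (\<lambda>u. genus_log p (exp (of_real u + \<tau>))) u"
    by (rule isCont_o2[rotated]) (intro continuous_intros)
qed

text \<open>
  An integrable majorant of the kernel, uniform in the shift \<open>v - u\<close> as long as its real part stays bounded
  and \<open>\<bar>Im v\<bar>\<close> stays away from \<open>\<pi>\<close>. The exponent \<open>\<beta> < \<sigma>\<close> is used for \<open>u \<ge> 0\<close> and \<open>p + 1 > \<sigma>\<close> for \<open>u < 0\<close>.
\<close>
lemma genus_log_kernel_bound:
  assumes \<epsilon>: "0 < \<epsilon>" "\<epsilon> \<le> pi" and \<sigma>: "real p < \<sigma>" "\<sigma> < real p + 1"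
    and \<beta>: "real p \<le> \<beta>" "0 < \<beta>" "\<beta> < \<sigma>"
  obtains C c where "C \<ge> 0" "c > 0"
    "\<And>u v. \<bar>Im v\<bar> \<le> pi - \<epsilon> \<Longrightarrow> \<bar>Re v - u\<bar> \<le> R \<Longrightarrow>
       exp (- \<sigma> * u) * norm (genus_log p (exp v)) \<le> C * exp (- c * \<bar>u\<bar>)"
proof
  define K where "K = 1 / (\<beta> * sqrt ((1 - cos \<epsilon>) / 2))"
  define C where "C = K * exp ((real p + 1) * \<bar>R\<bar>)"
  define c where "c = min (\<sigma> - \<beta>) (real p + 1 - \<sigma>)"
  have K0: "K \<ge> 0" using \<beta> by (auto simp: K_def intro!: divide_nonneg_nonneg mult_nonneg_nonneg)
  show "C \<ge> 0" using K0 by (simp add: C_def)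
  show "c > 0" using \<sigma> \<beta> by (simp add: c_def)
  fix u v assume v: "\<bar>Im v\<bar> \<le> pi - \<epsilon>" "\<bar>Re v - u\<bar> \<le> R"
  have bnd: "norm (genus_log p (exp v)) \<le> K * exp (b * u) * exp ((real p + 1) * \<bar>R\<bar>)"
    if b: "\<beta> \<le> b" "b \<le> real p + 1" for b
  proof -
    have b0: "b > 0" using b \<beta> by linarith
    have "norm (genus_log p (exp v)) \<le> exp (b * Re v) / (b * sqrt ((1 - cos \<epsilon>) / 2))"
      by (rule norm_genus_log_le[OF \<epsilon> v(1)]) (use b \<beta> in auto)
    also have "\<dots> = exp (b * Re v) * (1 / (b * sqrt ((1 - cos \<epsilon>) / 2)))" by simp
    also have "\<dots> \<le> exp (b * u + (real p + 1) * \<bar>R\<bar>) * K"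
    proof (intro mult_mono)
      have "b * (Re v - u) \<le> b * \<bar>R\<bar>" using v b0 by (intro mult_left_mono) auto
      also have "\<dots> \<le> (real p + 1) * \<bar>R\<bar>" using b by (intro mult_right_mono) auto
      finally show "exp (b * Re v) \<le> exp (b * u + (real p + 1) * \<bar>R\<bar>)" by (simp add: algebra_simps)
      have "cos \<epsilon> < cos 0" using \<epsilon> by (intro cos_monotone_0_pi) auto
      thus "1 / (b * sqrt ((1 - cos \<epsilon>) / 2)) \<le> K" unfolding K_def
        using b \<beta> b0 by (intro divide_left_mono mult_right_mono mult_pos_pos) auto
    qed (use b0 in \<open>auto intro!: mult_nonneg_nonneg\<close>)
    finally show ?thesis by (simp add: exp_add mult_ac)
  qed
  show "exp (- \<sigma> * u) * norm (genus_log p (exp v)) \<le> C * exp (- c * \<bar>u\<bar>)"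
  proof (cases "u \<ge> 0")
    case True
    have "exp (- \<sigma> * u) * norm (genus_log p (exp v)) \<le> exp (- \<sigma> * u) * (K * exp (\<beta> * u) * exp ((real p + 1) * \<bar>R\<bar>))"
      using \<beta> \<sigma> by (intro mult_left_mono bnd) auto
    also have "\<dots> = C * exp (- (\<sigma> - \<beta>) * u)" by (simp add: C_def algebra_simps flip: exp_add)
    also have "\<dots> \<le> C * exp (- c * u)"
    proof (intro mult_left_mono)
      have "c * u \<le> (\<sigma> - \<beta>) * u" using True by (intro mult_right_mono) (auto simp: c_def)
      thus "exp (- (\<sigma> - \<beta>) * u) \<le> exp (- c * u)" by (simp add: algebra_simps)
    qed fact
    finally show ?thesis using True by simp
  next
    case False
    have "exp (- \<sigma> * u) * norm (genus_log p (exp v)) \<le>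
       exp (- \<sigma> * u) * (K * exp ((real p + 1) * u) * exp ((real p + 1) * \<bar>R\<bar>))"
      using \<beta> \<sigma> by (intro mult_left_mono bnd) auto
    also have "\<dots> = C * exp ((real p + 1 - \<sigma>) * u)" by (simp add: C_def algebra_simps flip: exp_add)
    also have "\<dots> \<le> C * exp (c * u)"
    proof (intro mult_left_mono)
      have "(real p + 1 - \<sigma>) * u \<le> c * u" using False by (intro mult_right_mono_neg) (auto simp: c_def)
      thus "exp ((real p + 1 - \<sigma>) * u) \<le> exp (c * u)" by simp
    qed fact
    finally show ?thesis using False by simp
  qed
qed

lemma norm_exp_neg_mult: "norm (exp (- s * complex_of_real u)) = exp (- Re s * u)"
  by simp

lemma integrable_genus_log_kernel:
  assumes s: "real p < Re s" "Re s < real p + 1" and \<tau>: "\<bar>Im \<tau>\<bar> < pi"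
  shows "integrable lborel (\<lambda>u. exp (- s * of_real u) * genus_log p (exp (of_real u + \<tau>)))"
proof -
  obtain C c where C: "C \<ge> 0" "c > 0"
    "\<And>u v. \<bar>Im v\<bar> \<le> pi - (pi - \<bar>Im \<tau>\<bar>) \<Longrightarrow> \<bar>Re v - u\<bar> \<le> \<bar>Re \<tau>\<bar> \<Longrightarrow>
       exp (- Re s * u) * norm (genus_log p (exp v)) \<le> C * exp (- c * \<bar>u\<bar>)"
    by (rule genus_log_kernel_bound[of "pi - \<bar>Im \<tau>\<bar>" p "Re s" "(real p + Re s) / 2" "\<bar>Re \<tau>\<bar>"])
       (use s \<tau> in auto)
  show ?thesis
  proof (rule Bochner_Integration.integrable_bound)
    show "integrable lborel (\<lambda>u. C * exp (- c * \<bar>u\<bar>))"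
      using integrable_exp_minus_abs[OF C(2)] by (rule integrable_mult_right)
    show "(\<lambda>u. exp (- s * of_real u) * genus_log p (exp (of_real u + \<tau>))) \<in> borel_measurable lborel"
      using genus_log_exp_measurable[OF \<tau>, of p] by simp
    show "AE u in lborel. norm (exp (- s * of_real u) * genus_log p (exp (of_real u + \<tau>)))
             \<le> norm (C * exp (- c * \<bar>u\<bar>))"
      unfolding norm_mult norm_exp_neg_mult using C(1) C(3)[of "of_real u + \<tau>" u for u]
      by (intro AE_I2) simp
  qed
qed

text \<open>
  Integration by parts: the boundary terms of \<open>e^(-su) \<Lambda>(e^u)\<close> vanish, and the derivative of \<open>\<Lambda>(e^u)\<close> is
  \<open>\<plusminus>e^((p+1)u) / (1 + e^u)\<close>, whose transform is known.
\<close>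
lemma genus_log_mellin_unshifted:
  assumes s: "real p < Re s" "Re s < real p + 1"
  shows "(\<integral>u. exp (- s * of_real u) * genus_log p (exp (of_real u)) \<partial>lborel) =
           of_real pi / (s * sin (of_real pi * s))"
proof -
  have [simp]: "s \<noteq> 0" using s by auto
  define F where "F = (\<lambda>u::real. exp (- s * of_real u) * genus_log p (exp (of_real u)))"
  define G where "G = (\<lambda>u::real. exp ((of_nat p + 1 - s) * of_real u) / (1 + exp (of_real u)))"
  define f where "f = (\<lambda>u. - s * F u + (-1) ^ p * G u)"
  have z: "0 < Re (of_nat p + 1 - s)" "Re (of_nat p + 1 - s) < 1" using s by auto
  have intF: "integrable lborel F"
    unfolding F_def using integrable_genus_log_kernel[OF s, of 0] by simp
  have intG: "integrable lborel G" unfolding G_def by (rule logistic_mellin(2)[OF z])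
  have slit: "1 + exp (complex_of_real u) \<notin> \<real>\<^sub>\<le>\<^sub>0" for u
    by (rule one_plus_exp_slit) simp
  have deriv: "(F has_vector_derivative f u) (at u)" for u
  proof -
    let ?e = "exp (complex_of_real u)"
    have 1: "((\<lambda>z. genus_log p (exp z)) has_field_derivative (- ?e) ^ p / (1 + ?e) * ?e) (at (of_real u))"
      by (rule DERIV_chain2[where f = "genus_log p" and g = exp, OF has_field_derivative_genus_log[OF slit] DERIV_exp])
    have "((\<lambda>z. exp (- s * z) * genus_log p (exp z)) has_field_derivative
           - s * exp (- s * of_real u) * genus_log p ?e + (- ?e) ^ p / (1 + ?e) * ?e * exp (- s * of_real u)) (at (of_real u))"
      by (rule derivative_eq_intros 1 refl | simp)+
    from has_vector_derivative_real_field[OF this]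
    have "(F has_vector_derivative
        (- s * exp (- s * of_real u) * genus_log p ?e + (- ?e) ^ p / (1 + ?e) * ?e * exp (- s * of_real u))) (at u)"
      unfolding F_def .
    also have "(- ?e) ^ p / (1 + ?e) * ?e * exp (- s * of_real u) = (-1) ^ p * G u"
    proof -
      have "(- ?e) ^ p = (-1) ^ p * exp (of_nat p * of_real u)"
        by (simp add: power_minus[of ?e] exp_of_nat_mult)
      hence "(- ?e) ^ p * ?e * exp (- s * of_real u) = (-1) ^ p * exp ((of_nat p + 1 - s) * of_real u)"
        by (simp add: exp_add exp_diff exp_minus field_simps)
      thus ?thesis by (simp add: G_def field_simps)
    qed
    finally show ?thesis by (simp add: f_def F_def mult.assoc)
  qed
  obtain C c where C: "C \<ge> 0" "c > 0"
    "\<And>u v. \<bar>Im v\<bar> \<le> pi - pi \<Longrightarrow> \<bar>Re v - u\<bar> \<le> 0 \<Longrightarrow>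
       exp (- Re s * u) * norm (genus_log p (exp v)) \<le> C * exp (- c * \<bar>u\<bar>)"
    by (rule genus_log_kernel_bound[of pi p "Re s" "(real p + Re s) / 2" 0]) (use s in auto)
  have Fbound: "norm (F u) \<le> C * exp (- c * \<bar>u\<bar>)" for u
    unfolding F_def norm_mult norm_exp_neg_mult using C(3)[of "of_real u" u] by simp
  have lim_top: "(F \<longlongrightarrow> 0) at_top" and lim_bot: "(F \<longlongrightarrow> 0) at_bot"
  proof -
    have "((\<lambda>u. C * exp (- c * \<bar>u\<bar>)) \<longlongrightarrow> 0) at_top" "((\<lambda>u. C * exp (- c * \<bar>u\<bar>)) \<longlongrightarrow> 0) at_bot"
      using C(2) by real_asymp+
    thus "(F \<longlongrightarrow> 0) at_top" "(F \<longlongrightarrow> 0) at_bot"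
      using Fbound by (auto intro: Lim_null_comparison[rotated] always_eventually)
  qed
  have einU: "einterval (-\<infinity>) \<infinity> = UNIV" by (auto simp: einterval_def)
  have "(LBINT u=-\<infinity>..\<infinity>. f u) = 0 - 0"
  proof (rule interval_integral_FTC_integrable[where F = F])
    show "isCont f u" for u
    proof -
      have "isCont F u" by (rule has_vector_derivative_continuous[OF deriv])
      moreover have "isCont G u"
      proof -
        have "1 + exp (complex_of_real u) \<noteq> 0" using slit[of u] by force
        thus ?thesis unfolding G_def by (intro continuous_intros)
      qed
      ultimately show ?thesis unfolding f_def by (intro continuous_intros)
    qed
    show "set_integrable lborel (einterval (-\<infinity>) \<infinity>) f"
      unfolding einU using intF intG by (simp add: set_integrable_def f_def)
    show "((F \<circ> real_of_ereal) \<longlongrightarrow> 0) (at_right (-\<infinity>))"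
      unfolding ereal_tendsto_simps1 by (rule lim_bot)
    show "((F \<circ> real_of_ereal) \<longlongrightarrow> 0) (at_left \<infinity>)"
      unfolding ereal_tendsto_simps1 by (rule lim_top)
  qed (use deriv in auto)
  hence "0 = (\<integral>u. f u \<partial>lborel)"
    by (simp add: interval_lebesgue_integral_def einU set_lebesgue_integral_def)
  also have "\<dots> = - s * (\<integral>u. F u \<partial>lborel) + (-1) ^ p * (\<integral>u. G u \<partial>lborel)"
    unfolding f_def using intF intG by simp
  finally have "s * (\<integral>u. F u \<partial>lborel) = (-1) ^ p * (\<integral>u. G u \<partial>lborel)" by simp
  also have "(\<integral>u. G u \<partial>lborel) = of_real pi / sin (of_real pi * (of_nat p + 1 - s))"
    unfolding G_def by (rule logistic_mellin(1)[OF z])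
  also have "sin (of_real pi * (of_nat p + 1 - s)) = (-1) ^ p * sin (of_real pi * s)"
  proof -
    have "sin (complex_of_real pi * (of_nat p + 1 - s)) =
          sin (of_real pi - of_real pi * s + of_real (of_nat p * pi))"
      by (simp add: algebra_simps)
    also have "\<dots> = (-1) ^ p * sin (of_real pi * s)"
      by (simp add: sin_add sin_diff sin_of_real cos_of_real)
    finally show ?thesis .
  qed
  finally have "s * (\<integral>u. F u \<partial>lborel) = of_real pi / sin (of_real pi * s)" by simp
  hence "(\<integral>u. F u \<partial>lborel) = of_real pi / sin (of_real pi * s) / s"
    by (metis \<open>s \<noteq> 0\<close> nonzero_mult_div_cancel_left)
  thus ?thesis by (simp add: F_def mult.commute)
qed

text \<open>
  For real \<open>\<tau>\<close> this is translation invariance of Lebesgue measure. Both sides are holomorphic in \<open>\<tau>\<close> on the strip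
  \<open>\<bar>Im \<tau>\<bar> < \<pi>\<close>, so they agree there.
\<close>
lemma genus_log_mellin:
  assumes s: "real p < Re s" "Re s < real p + 1" and \<tau>: "\<bar>Im \<tau>\<bar> < pi"
  shows "(\<integral>u. exp (- s * of_real u) * genus_log p (exp (of_real u + \<tau>)) \<partial>lborel) =
           exp (s * \<tau>) * (of_real pi / (s * sin (of_real pi * s)))"
proof -
  define K where "K = (\<lambda>\<tau>. \<integral>u. exp (- s * of_real u) * genus_log p (exp (of_real u + \<tau>)) \<partial>lborel)"
  let ?S = "{\<tau>. \<bar>Im \<tau>\<bar> < pi}"
  have S: "?S = {\<tau>. Im \<tau> < pi} \<inter> {\<tau>. Im \<tau> > - pi}" by auto
  have openS: "open ?S" unfolding S by (intro open_Int open_halfspace_Im_gt open_halfspace_Im_lt)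
  have conS: "connected ?S" unfolding S
    by (intro convex_connected convex_Int convex_halfspace_Im_gt convex_halfspace_Im_lt)
  have K: "K holomorphic_on ?S"
    unfolding holomorphic_on_open[OF openS]
  proof safe
    fix \<tau>0 assume \<tau>0: "\<bar>Im \<tau>0\<bar> < pi"
    define r where "r = (pi - \<bar>Im \<tau>0\<bar>) / 2"
    have r: "r > 0" using \<tau>0 by (simp add: r_def)
    obtain C c where C: "C \<ge> 0" "c > 0"
      "\<And>u v. \<bar>Im v\<bar> \<le> pi - r \<Longrightarrow> \<bar>Re v - u\<bar> \<le> \<bar>Re \<tau>0\<bar> + r \<Longrightarrow>
         exp (- Re s * u) * norm (genus_log p (exp v)) \<le> C * exp (- c * \<bar>u\<bar>)"
      by (rule genus_log_kernel_bound[of r p "Re s" "(real p + Re s) / 2" "\<bar>Re \<tau>0\<bar> + r"])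
         (use s \<tau>0 r in \<open>auto simp: r_def field_simps\<close>)
    have ball: "\<bar>Im \<tau>\<bar> \<le> pi - r \<and> \<bar>Im \<tau>\<bar> < pi \<and> \<bar>Re \<tau>\<bar> \<le> \<bar>Re \<tau>0\<bar> + r" if "\<tau> \<in> ball \<tau>0 r" for \<tau>
    proof -
      have "norm (\<tau> - \<tau>0) < r" using that by (simp add: dist_norm norm_minus_commute)
      hence "\<bar>Im \<tau> - Im \<tau>0\<bar> < r" "\<bar>Re \<tau> - Re \<tau>0\<bar> < r"
        using abs_Im_le_cmod[of "\<tau> - \<tau>0"] abs_Re_le_cmod[of "\<tau> - \<tau>0"] by auto
      moreover have "pi = \<bar>Im \<tau>0\<bar> + 2 * r" by (simp add: r_def field_simps)
      ultimately show ?thesis using r by (smt (verit))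
    qed
    have "(K has_field_derivative
        (\<integral>u. deriv (\<lambda>\<tau>. exp (- s * of_real u) * genus_log p (exp (of_real u + \<tau>))) \<tau>0 \<partial>lborel)) (at \<tau>0)"
      unfolding K_def
    proof (rule has_field_derivative_lebesgue_integral[OF r])
      show "(\<lambda>\<tau>. exp (- s * of_real u) * genus_log p (exp (of_real u + \<tau>))) holomorphic_on ball \<tau>0 r" for u
      proof (intro holomorphic_intros)
        show "(\<lambda>\<tau>. genus_log p (exp (of_real u + \<tau>))) holomorphic_on ball \<tau>0 r"
          unfolding holomorphic_on_open[OF open_ball]
        proof
          fix \<tau> assume "\<tau> \<in> ball \<tau>0 r"
          with ball have "\<bar>Im (of_real u + \<tau>)\<bar> < pi" by auto
          note d = has_field_derivative_genus_log[OF one_plus_exp_slit[OF this], of p]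
          have e: "((\<lambda>\<tau>. exp (of_real u + \<tau>)) has_field_derivative exp (of_real u + \<tau>)) (at \<tau>)"
            by (auto intro!: derivative_eq_intros)
          show "\<exists>f'. ((\<lambda>\<tau>. genus_log p (exp (of_real u + \<tau>))) has_field_derivative f') (at \<tau>)"
            by (rule exI, rule DERIV_chain2[where f = "genus_log p", OF d e])
        qed
      qed
      show "(\<lambda>u. exp (- s * of_real u) * genus_log p (exp (of_real u + \<tau>))) \<in> borel_measurable lborel"
        if "\<tau> \<in> ball \<tau>0 r" for \<tau>
        using genus_log_exp_measurable[of \<tau> p] ball[OF that] by simp
      show "integrable lborel (\<lambda>u. C * exp (- c * \<bar>u\<bar>))"
        using integrable_exp_minus_abs[OF C(2)] by (rule integrable_mult_right)
      show "norm (exp (- s * of_real u) * genus_log p (exp (of_real u + \<tau>))) \<le> C * exp (- c * \<bar>u\<bar>)"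
        if "\<tau> \<in> ball \<tau>0 r" for \<tau> u
        unfolding norm_mult norm_exp_neg_mult using C(3)[of "of_real u + \<tau>" u] ball[OF that] by simp
    qed
    thus "\<exists>f'. (K has_field_derivative f') (at \<tau>0)" by blast
  qed
  have "K \<tau> - exp (s * \<tau>) * K 0 = 0"
  proof (rule analytic_continuation[where S = ?S and w = \<tau> and \<xi> = 0 and
          f = "\<lambda>\<tau>. K \<tau> - exp (s * \<tau>) * K 0" and U = "of_real ` (UNIV :: real set)"])
    show "(\<lambda>\<tau>. K \<tau> - exp (s * \<tau>) * K 0) holomorphic_on ?S"
      by (intro holomorphic_intros K)
    have "complex_of_real 0 islimpt of_real ` UNIV"
      by (intro islimpt_of_real_image) simp
    thus "0 islimpt complex_of_real ` UNIV" by simp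
  next
    fix w assume "w \<in> complex_of_real ` UNIV"
    then obtain r :: real where r: "w = of_real r" by auto
    have "K 0 * exp (s * w) = (\<integral>u. exp (s * w) * (exp (- s * of_real u) * genus_log p (exp (of_real u))) \<partial>lborel)"
      by (simp add: K_def)
    also have "\<dots> = (\<integral>u. exp (s * w) * (exp (- s * of_real (r + 1 * u)) * genus_log p (exp (of_real (r + 1 * u)))) \<partial>lborel)"
      by (subst lborel_integral_real_affine[of 1 _ r]) simp_all
    also have "\<dots> = K w"
      unfolding K_def
    proof (rule Bochner_Integration.integral_cong[OF refl])
      fix u :: real
      have "exp (s * w) * exp (- s * of_real (r + 1 * u)) = exp (- s * of_real u)"
        by (simp add: r algebra_simps flip: exp_add)
      thus "exp (s * w) * (exp (- s * of_real (r + 1 * u)) * genus_log p (exp (of_real (r + 1 * u)))) =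
            exp (- s * of_real u) * genus_log p (exp (of_real u + w))"
        by (simp add: r mult.assoc[symmetric] add.commute)
    qed
    finally show "K w - exp (s * w) * K 0 = 0" by (simp add: mult.commute)
  qed (use openS conS \<tau> in auto)
  thus ?thesis
    using genus_log_mellin_unshifted[OF s] by (simp add: K_def)
qed

section \<open>Summation over the sequence\<close>

lemma norm_exp_mult_le:
  assumes "\<bar>Im w\<bar> \<le> pi"
  shows "norm (exp (s * w)) \<le> exp (\<bar>Im s\<bar> * pi) * exp (Re s * Re w)"
proof -
  have "norm (exp (s * w)) = exp (- Im s * Im w) * exp (Re s * Re w)"
    by (simp flip: exp_add)
  also have "\<dots> \<le> exp (\<bar>Im s\<bar> * pi) * exp (Re s * Re w)"
  proof -
    have "- Im s * Im w \<le> \<bar>Im s\<bar> * \<bar>Im w\<bar>" by (metis abs_ge_self abs_minus_cancel abs_mult)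
    also have "\<dots> \<le> \<bar>Im s\<bar> * pi" using assms by (intro mult_left_mono) auto
    finally show ?thesis by simp
  qed
  finally show ?thesis .
qed

lemma summable_exp_mult:
  assumes "\<And>n. \<bar>Im (\<tau> n)\<bar> \<le> pi" and "summable (\<lambda>n. exp (Re s * Re (\<tau> n)))"
  shows "summable (\<lambda>n. exp (s * \<tau> n))"
  by (rule summable_norm_cancel,
      rule summable_comparison_test_ev[OF always_eventually summable_mult[OF assms(2)]])
     (use norm_exp_mult_le[OF assms(1)] in auto)

lemma genus_log_term_bound:
  assumes \<epsilon>: "0 < \<epsilon>" "\<epsilon> \<le> pi" and Im: "\<bar>Im v\<bar> \<le> pi - \<epsilon>"
    and \<beta>: "0 < \<beta>" "real p \<le> \<beta>" "\<beta> \<le> real p + 1"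
  shows "norm (genus_log p (exp (of_real u + v))) \<le>
           1 / (\<beta> * sqrt ((1 - cos \<epsilon>) / 2)) * exp (\<beta> * u) * exp (\<beta> * Re v)"
  using norm_genus_log_le[OF \<epsilon> _ \<beta>, of "of_real u + v"] Im
  by (simp add: algebra_simps exp_add)

text \<open>
  Termwise bounds by \<open>exp (\<beta> Re \<tau>\<^sub>n)\<close> with \<open>\<beta> > \<alpha>\<close> give convergence, continuity and growth of the series. For the
  transform, sum and integral may be exchanged because the integral of the \<open>n\<close>-th term is, after the
  translation by \<open>Re \<tau>\<^sub>n\<close>, at most a constant times \<open>exp (Re s * Re \<tau>\<^sub>n)\<close>.
\<close>
lemma
  fixes \<tau> :: "nat \<Rightarrow> complex"
  assumes \<epsilon>: "0 < \<epsilon>" "\<epsilon> \<le> pi" and Im: "\<And>n. \<bar>Im (\<tau> n)\<bar> \<le> pi - \<epsilon>"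
    and \<alpha>: "0 \<le> \<alpha>" "real p \<le> \<alpha>" "\<alpha> < real p + 1"
    and sum: "\<And>\<beta>. \<beta> > \<alpha> \<Longrightarrow> summable (\<lambda>n. exp (\<beta> * Re (\<tau> n)))"
  shows summable_genus_log_series:
      "summable (\<lambda>n. norm (genus_log p (exp (of_real u + \<tau> n))))"
    and genus_log_series_bound:
      "\<alpha> < \<beta> \<Longrightarrow> \<beta> \<le> real p + 1 \<Longrightarrow>
         \<exists>C. \<forall>u. norm (\<Sum>n. genus_log p (exp (of_real u + \<tau> n))) \<le> C * exp (\<beta> * u)"
    and isCont_genus_log_series:
      "isCont (\<lambda>u. \<Sum>n. genus_log p (exp (of_real u + \<tau> n))) u"
    and genus_log_series_mellin:
      "\<alpha> < Re s \<Longrightarrow> Re s < real p + 1 \<Longrightarrow>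
         (\<integral>u. exp (- s * of_real u) * (\<Sum>n. genus_log p (exp (of_real u + \<tau> n))) \<partial>lborel) =
         (\<Sum>n. exp (s * \<tau> n)) * (of_real pi / (s * sin (of_real pi * s)))"
proof -
  define K where "K = (\<lambda>\<beta>. 1 / (\<beta> * sqrt ((1 - cos \<epsilon>) / 2)))"
  have bnd: "norm (genus_log p (exp (of_real u + \<tau> n))) \<le> K \<beta> * exp (\<beta> * u) * exp (\<beta> * Re (\<tau> n))"
    if "\<alpha> < \<beta>" "\<beta> \<le> real p + 1" for \<beta> u n
    unfolding K_def by (rule genus_log_term_bound[OF \<epsilon> Im]) (use that \<alpha> in auto)
  have K0: "K \<beta> \<ge> 0" if "\<alpha> < \<beta>" for \<beta>
    using that \<alpha> by (auto simp: K_def intro!: divide_nonneg_nonneg mult_nonneg_nonneg)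
  have summ: "summable (\<lambda>n. norm (genus_log p (exp (of_real u + \<tau> n))))" for u
  proof (rule summable_comparison_test_ev)
    show "\<forall>\<^sub>F n in sequentially. norm (norm (genus_log p (exp (of_real u + \<tau> n)))) \<le>
        K (real p + 1) * exp ((real p + 1) * u) * exp ((real p + 1) * Re (\<tau> n))"
      using bnd[of "real p + 1"] \<alpha> by (intro always_eventually) auto
    show "summable (\<lambda>n. K (real p + 1) * exp ((real p + 1) * u) * exp ((real p + 1) * Re (\<tau> n)))"
      by (intro summable_mult sum) (use \<alpha> in auto)
  qed
  thus "summable (\<lambda>n. norm (genus_log p (exp (of_real u + \<tau> n))))" for u .
  show "\<exists>C. \<forall>u. norm (\<Sum>n. genus_log p (exp (of_real u + \<tau> n))) \<le> C * exp (\<beta> * u)"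
    if \<beta>: "\<alpha> < \<beta>" "\<beta> \<le> real p + 1" for \<beta>
  proof (intro exI allI)
    fix u :: real
    have "norm (\<Sum>n. genus_log p (exp (of_real u + \<tau> n))) \<le>
            (\<Sum>n. norm (genus_log p (exp (of_real u + \<tau> n))))"
      by (rule summable_norm[OF summ])
    also have "\<dots> \<le> (\<Sum>n. K \<beta> * exp (\<beta> * u) * exp (\<beta> * Re (\<tau> n)))"
      by (intro suminf_le summ summable_mult sum bnd \<beta>)
    also have "\<dots> = (K \<beta> * (\<Sum>n. exp (\<beta> * Re (\<tau> n)))) * exp (\<beta> * u)"
      using sum[OF \<beta>(1)] by (simp add: suminf_mult)
    finally show "norm (\<Sum>n. genus_log p (exp (of_real u + \<tau> n))) \<le>
                   (K \<beta> * (\<Sum>n. exp (\<beta> * Re (\<tau> n)))) * exp (\<beta> * u)" .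
  qed
  have Im': "\<bar>Im (\<tau> n)\<bar> < pi" for n using Im[of n] \<epsilon> by linarith
  show "isCont (\<lambda>u. \<Sum>n. genus_log p (exp (of_real u + \<tau> n))) u" for u
  proof -
    define M where "M = (\<lambda>n. K (real p + 1) * exp ((real p + 1) * (u + 1)) * exp ((real p + 1) * Re (\<tau> n)))"
    have unif: "uniform_limit {..<u+1} (\<lambda>N x. \<Sum>n<N. genus_log p (exp (of_real x + \<tau> n)))
            (\<lambda>x. \<Sum>n. genus_log p (exp (of_real x + \<tau> n))) sequentially"
    proof (rule Weierstrass_m_test)
      show "summable M" unfolding M_def by (intro summable_mult sum) (use \<alpha> in auto)
      fix n x assume x: "x \<in> {..<u+1}"
      have "norm (genus_log p (exp (of_real x + \<tau> n))) \<le>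
              K (real p + 1) * exp ((real p + 1) * x) * exp ((real p + 1) * Re (\<tau> n))"
        using bnd[of "real p + 1"] \<alpha> by auto
      also have "\<dots> \<le> M n"
        unfolding M_def using x K0[of "real p + 1"] \<alpha> by (intro mult_right_mono mult_left_mono) auto
      finally show "norm (genus_log p (exp (of_real x + \<tau> n))) \<le> M n" .
    qed
    have "isCont (\<lambda>u. genus_log p (exp (of_real u + \<tau> n))) x" for n x
    proof -
      have "isCont (genus_log p) (exp (of_real x + \<tau> n))"
        by (rule DERIV_isCont[OF has_field_derivative_genus_log[OF one_plus_exp_slit]]) (use Im' in simp)
      thus ?thesis by (rule isCont_o2[rotated]) (intro continuous_intros)
    qed
    hence "continuous_on {..<u+1} (\<lambda>x. \<Sum>n<N. genus_log p (exp (of_real x + \<tau> n)))" for N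
      by (intro continuous_on_sum continuous_at_imp_continuous_on) auto
    hence "continuous_on {..<u+1} (\<lambda>x. \<Sum>n. genus_log p (exp (of_real x + \<tau> n)))"
      by (intro uniform_limit_theorem[OF _ unif] always_eventually) auto
    thus ?thesis by (simp add: continuous_on_eq_continuous_at)
  qed
  show "(\<integral>u. exp (- s * of_real u) * (\<Sum>n. genus_log p (exp (of_real u + \<tau> n))) \<partial>lborel) =
         (\<Sum>n. exp (s * \<tau> n)) * (of_real pi / (s * sin (of_real pi * s)))"
    if s: "\<alpha> < Re s" "Re s < real p + 1" for s
  proof -
    define f where "f = (\<lambda>n u. exp (- s * complex_of_real u) * genus_log p (exp (of_real u + \<tau> n)))"
    have s': "real p < Re s" using s \<alpha> by simp
    have intf: "integrable lborel (f n)" for n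
      unfolding f_def by (rule integrable_genus_log_kernel[OF s' s(2) Im'])
    have sumf: "summable (\<lambda>n. norm (f n u))" for u
      unfolding f_def norm_mult by (intro summable_mult summ)
    obtain C c where C: "C \<ge> 0" "c > 0"
      "\<And>u v. \<bar>Im v\<bar> \<le> pi - \<epsilon> \<Longrightarrow> \<bar>Re v - u\<bar> \<le> 0 \<Longrightarrow>
         exp (- Re s * u) * norm (genus_log p (exp v)) \<le> C * exp (- c * \<bar>u\<bar>)"
      by (rule genus_log_kernel_bound[of \<epsilon> p "Re s" "(real p + Re s) / 2" 0])
         (use s s' \<epsilon> in auto)
    have intg: "integrable lborel (\<lambda>u. exp (- c * \<bar>x + u\<bar>))"
      and valg: "(\<integral>u. exp (- c * \<bar>x + u\<bar>) \<partial>lborel) = (\<integral>u. exp (- c * \<bar>u\<bar>) \<partial>lborel)" for x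
      using lborel_integrable_real_affine[OF integrable_exp_minus_abs[OF C(2)], of 1 x]
            lborel_integral_real_affine[of 1 "\<lambda>u. exp (- c * \<bar>u\<bar>)" x] by simp_all
    \<comment> \<open>the kernel bound at \<open>u + Re \<tau>\<^sub>n\<close>, at the cost of the factor \<open>exp (Re s * Re \<tau>\<^sub>n)\<close>\<close>
    have fb: "norm (f n u) \<le> C * exp (Re s * Re (\<tau> n)) * exp (- c * \<bar>Re (\<tau> n) + u\<bar>)" for n u
    proof -
      have "norm (f n u) = exp (Re s * Re (\<tau> n)) *
              (exp (- Re s * (Re (\<tau> n) + u)) * norm (genus_log p (exp (of_real u + \<tau> n))))"
        unfolding f_def norm_mult norm_exp_neg_mult by (simp add: algebra_simps flip: exp_add)
      also have "\<dots> \<le> exp (Re s * Re (\<tau> n)) * (C * exp (- c * \<bar>Re (\<tau> n) + u\<bar>))"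
        by (intro mult_left_mono C(3)) (use Im in auto)
      finally show ?thesis by (simp add: mult_ac)
    qed
    have "(\<integral>u. norm (f n u) \<partial>lborel) \<le> C * (\<integral>u. exp (- c * \<bar>u\<bar>) \<partial>lborel) * exp (Re s * Re (\<tau> n))" for n
    proof -
      have "(\<integral>u. norm (f n u) \<partial>lborel) \<le> (\<integral>u. C * exp (Re s * Re (\<tau> n)) * exp (- c * \<bar>Re (\<tau> n) + u\<bar>) \<partial>lborel)"
        using fb[of n] intf[of n] intg by (intro integral_mono) auto
      thus ?thesis using valg[of "Re (\<tau> n)"] by (simp add: mult_ac)
    qed
    hence sumi: "summable (\<lambda>n. \<integral>u. norm (f n u) \<partial>lborel)"
      by (intro summable_comparison_test_ev[OF always_eventually summable_mult[OF sum[OF s(1)]]])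
         auto
    have "(\<integral>u. exp (- s * of_real u) * (\<Sum>n. genus_log p (exp (of_real u + \<tau> n))) \<partial>lborel) =
          (\<integral>u. (\<Sum>n. f n u) \<partial>lborel)"
      unfolding f_def using summ by (subst suminf_mult) (auto intro: summable_norm_cancel)
    also have "\<dots> = (\<Sum>n. \<integral>u. f n u \<partial>lborel)"
      by (rule integral_suminf[OF intf _ sumi]) (use sumf in auto)
    also have "\<dots> = (\<Sum>n. exp (s * \<tau> n) * (of_real pi / (s * sin (of_real pi * s))))"
      unfolding f_def by (subst genus_log_mellin[OF s' s(2) Im']) simp
    also have "\<dots> = (\<Sum>n. exp (s * \<tau> n)) * (of_real pi / (s * sin (of_real pi * s)))"
      by (rule suminf_mult2[symmetric], rule summable_exp_mult[OF less_imp_le[OF Im'] sum[OF s(1)]])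
    finally show ?thesis .
  qed
qed

text \<open>
  Since \<open>Re \<tau>\<^sub>n\<close> may have either sign for small \<open>n\<close>, the dominating sequence near \<open>s\<close> uses the two
  exponents \<open>Re s - r\<close> and \<open>Re s + r\<close>. The derivative is obtained from the lemma on parameter integrals, with counting measure.
\<close>
lemma holomorphic_exp_series:
  fixes \<tau> :: "nat \<Rightarrow> complex"
  assumes Im: "\<And>n. \<bar>Im (\<tau> n)\<bar> \<le> pi"
    and sum: "\<And>\<beta>. \<beta> > \<alpha> \<Longrightarrow> summable (\<lambda>n. exp (\<beta> * Re (\<tau> n)))"
  shows "(\<lambda>s. \<Sum>n. exp (s * \<tau> n)) holomorphic_on {s. Re s > \<alpha>}"
  unfolding holomorphic_on_open[OF open_halfspace_Re_gt]
proof safe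
  fix s assume s: "Re s > \<alpha>"
  define r where "r = (Re s - \<alpha>) / 2"
  have r: "r > 0" using s by (simp add: r_def)
  define g where "g = (\<lambda>n. exp ((\<bar>Im s\<bar> + r) * pi) * (exp ((Re s - r) * Re (\<tau> n)) + exp ((Re s + r) * Re (\<tau> n))))"
  have bnd: "norm (exp (z * \<tau> n)) \<le> g n" if z: "z \<in> ball s r" for z n
  proof -
    have "norm (z - s) < r" using z by (simp add: dist_norm norm_minus_commute)
    hence *: "\<bar>Im z - Im s\<bar> < r" "\<bar>Re z - Re s\<bar> < r"
      using abs_Im_le_cmod[of "z - s"] abs_Re_le_cmod[of "z - s"] by auto
    have "norm (exp (z * \<tau> n)) \<le> exp (\<bar>Im z\<bar> * pi) * exp (Re z * Re (\<tau> n))"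
      by (rule norm_exp_mult_le[OF Im])
    also have "\<dots> \<le> g n" unfolding g_def
    proof (intro mult_mono)
      show "exp (\<bar>Im z\<bar> * pi) \<le> exp ((\<bar>Im s\<bar> + r) * pi)" using * by auto
      show "exp (Re z * Re (\<tau> n)) \<le> exp ((Re s - r) * Re (\<tau> n)) + exp ((Re s + r) * Re (\<tau> n))"
      proof (cases "Re (\<tau> n) \<ge> 0")
        case True
        hence "Re z * Re (\<tau> n) \<le> (Re s + r) * Re (\<tau> n)" using * by (intro mult_right_mono) auto
        thus ?thesis by (simp add: add_increasing)
      next
        case False
        hence "Re z * Re (\<tau> n) \<le> (Re s - r) * Re (\<tau> n)" using * by (intro mult_right_mono_neg) auto
        thus ?thesis by (simp add: add_increasing2)
      qed
    qed auto
    finally show ?thesis .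
  qed
  have sumg: "summable g"
    unfolding g_def by (intro summable_mult summable_add sum) (use s r in \<open>auto simp: r_def field_simps\<close>)
  have intg: "integrable (count_space UNIV) g"
    unfolding integrable_count_space_nat_iff
    by (rule summable_cong[THEN iffD1, OF _ sumg]) (auto simp: g_def)
  have "((\<lambda>s. \<integral>n. exp (s * \<tau> n) \<partial>count_space UNIV) has_field_derivative
          (\<integral>n. deriv (\<lambda>s. exp (s * \<tau> n)) s \<partial>count_space UNIV)) (at s)"
    by (rule has_field_derivative_lebesgue_integral[OF r _ _ intg bnd])
       (auto intro!: holomorphic_intros)
  moreover have "(\<integral>n. exp (z * \<tau> n) \<partial>count_space UNIV) = (\<Sum>n. exp (z * \<tau> n))" if "z \<in> ball s r" for z
  proof (rule integral_count_space_nat, unfold integrable_count_space_nat_iff)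
    show "summable (\<lambda>n. norm (exp (z * \<tau> n)))"
      by (rule summable_comparison_test_ev[OF always_eventually sumg]) (use bnd[OF that] in auto)
  qed
  ultimately have "((\<lambda>s. \<Sum>n. exp (s * \<tau> n)) has_field_derivative
          (\<integral>n. deriv (\<lambda>s. exp (s * \<tau> n)) s \<partial>count_space UNIV)) (at s)"
    using r by (elim has_field_derivative_transform_within_open[where S = "ball s r"]) auto
  thus "\<exists>f'. ((\<lambda>s. \<Sum>n. exp (s * \<tau> n)) has_field_derivative f') (at s)" by blast
qed

section \<open>Taylor coefficients, arguments and the convergence exponent\<close>

text \<open>
  Decay along a single ray determines the order of the zero: divided by \<open>z^q\<close>, with \<open>q\<close> the order, the function has
  a non-zero limit at the origin.
\<close>
lemma fps_nth_eq_0_if_small_on_ray: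
  fixes f :: "complex \<Rightarrow> complex"
  assumes f: "f has_fps_expansion g"
    and small: "\<And>u. u < 0 \<Longrightarrow> norm (f (exp (of_real u + \<i> * of_real \<psi>))) \<le> C * exp ((real p + 1) * u)"
    and j: "j \<le> p"
  shows "fps_nth g j = 0"
proof (rule ccontr)
  assume nz: "fps_nth g j \<noteq> 0"
  define q where "q = subdegree g"
  have q: "q \<le> p" using subdegree_leI[OF nz] j by (simp add: q_def)
  have gq: "fps_nth g q \<noteq> 0" using nz by (auto simp: q_def)
  define z where "z = (\<lambda>u::real. exp (of_real u + \<i> * of_real \<psi>))"
  have z0: "z u \<noteq> 0" for u by (simp add: z_def)
  have nz: "norm (z u) = exp u" for u by (simp add: z_def)
  have "((\<lambda>u. norm (z u)) \<longlongrightarrow> 0) at_bot" unfolding nz by (rule exp_at_bot)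
  hence zlim: "(z \<longlongrightarrow> 0) at_bot" by (rule tendsto_norm_zero_cancel)
  define h where "h = (\<lambda>x. if x = 0 then fps_nth g q else f x / x ^ q)"
  have "h has_fps_expansion fps_shift q g"
    unfolding h_def by (rule has_fps_expansion_shift[OF f]) (auto simp: q_def)
  hence "isCont h 0" by (rule has_fps_expansion_imp_continuous)
  from isCont_tendsto_compose[OF this zlim] have lim1: "((\<lambda>u. h (z u)) \<longlongrightarrow> fps_nth g q) at_bot"
    by (simp add: h_def)
  have "((\<lambda>u. h (z u)) \<longlongrightarrow> 0) at_bot"
  proof (rule Lim_null_comparison)
    show "\<forall>\<^sub>F u in at_bot. norm (h (z u)) \<le> C * exp ((real p + 1 - real q) * u)"
      using eventually_gt_at_bot[of 0]
    proof eventually_elim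
      case (elim u)
      have "norm (h (z u)) = norm (f (z u)) / exp u ^ q"
        by (simp add: h_def z0 norm_divide norm_power nz)
      also have "\<dots> \<le> C * exp ((real p + 1) * u) / exp u ^ q"
        using small[OF elim] by (intro divide_right_mono) (auto simp: z_def)
      also have "\<dots> = C * exp ((real p + 1 - real q) * u)"
        by (simp add: exp_diff algebra_simps flip: exp_of_nat_mult)
      finally show ?case .
    qed
    have "real p + 1 - real q > 0" using q by simp
    thus "((\<lambda>u. C * exp ((real p + 1 - real q) * u)) \<longlongrightarrow> 0) at_bot" by real_asymp
  qed
  from tendsto_unique[OF _ this lim1] gq show False by simp
qed

lemma poly_has_fps_expansion:
  fixes \<omega> :: "complex poly"
  shows "poly \<omega> has_fps_expansion Abs_fps (coeff \<omega>)"
proof (rule has_fps_expansionI, rule always_eventually, rule allI)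
  fix u
  have "(\<lambda>n. coeff \<omega> n * u ^ n) sums (\<Sum>n\<le>degree \<omega>. coeff \<omega> n * u ^ n)"
    by (rule sums_finite) (auto simp: coeff_eq_0)
  thus "(\<lambda>n. fps_nth (Abs_fps (coeff \<omega>)) n * u ^ n) sums poly \<omega> u"
    by (simp add: poly_altdef)
qed

text \<open>
  Put \<open>F = e^\<omega> G\<close> with \<open>G = 1 + O(z^(p+1))\<close>. Then \<open>F' = \<omega>' F + G' e^\<omega>\<close>, and the last term has no coefficients of index
  below \<open>p\<close>. Comparing coefficients of \<open>F' = \<omega>' F\<close> there gives the recursion that defines the \<open>b\<^sub>j\<close>.
\<close>
lemma log_coefficients_unique:
  fixes F G :: "complex \<Rightarrow> complex" and \<omega> :: "complex poly" and b c :: "nat \<Rightarrow> complex"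
  assumes F: "\<And>z. (\<lambda>j. c j * z ^ j) sums F z"
    and c0: "c 0 \<noteq> 0"
    and small: "\<And>u. u < 0 \<Longrightarrow> norm (F (exp (of_real u + \<i> * of_real \<psi>)) *
        exp (- poly \<omega> (exp (of_real u + \<i> * of_real \<psi>))) - 1) \<le> C * exp ((real p + 1) * u)"
    and b_1: "b 1 = c 1 / c 0"
    and b_rec: "\<And>j. j \<ge> 2 \<Longrightarrow>
      b j = c j / c 0 - (\<Sum>l=1..j-1. of_nat l / of_nat j * (c (j - l) / c 0) * b l)"
    and j: "1 \<le> j" "j \<le> p"
  shows "b j = coeff \<omega> j"
proof -
  define f where "f = Abs_fps c"
  define w where "w = Abs_fps (coeff \<omega>)"
  define w' where "w' = Abs_fps (coeff (pderiv \<omega>))"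
  have Fexp: "F has_fps_expansion f"
    by (rule has_fps_expansionI) (use F in \<open>auto simp: f_def intro!: always_eventually\<close>)
  define E where "E = (\<lambda>z. exp (poly \<omega> z))"
  define e where "e = fps_expansion E 0"
  have Eexp: "E has_fps_expansion e"
    unfolding e_def E_def
    by (rule has_fps_expansion_fps_expansion[of UNIV]) (auto intro!: holomorphic_intros)
  have "deriv E = (\<lambda>z. poly (pderiv \<omega>) z * E z)"
    unfolding E_def by (intro ext DERIV_imp_deriv) (auto intro!: derivative_eq_intros poly_DERIV)
  moreover have "(\<lambda>z. poly (pderiv \<omega>) z * E z) has_fps_expansion w' * e"
    unfolding w'_def by (intro has_fps_expansion_mult poly_has_fps_expansion Eexp)
  moreover have "deriv E has_fps_expansion fps_deriv e"
    by (rule has_fps_expansion_deriv[OF Eexp])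
  \<comment> \<open>\<open>e\<close> is the expansion of \<open>exp \<circ> \<omega>\<close>, so its formal derivative is read off from the chain rule\<close>
  ultimately have e': "fps_deriv e = w' * e"
    using fps_expansion_unique_complex by metis
  define G where "G = (\<lambda>z. F z * exp (- poly \<omega> z))"
  define g where "g = f * fps_expansion (\<lambda>z. exp (- poly \<omega> z)) 0"
  have Gexp: "G has_fps_expansion g"
    unfolding G_def g_def
    by (intro has_fps_expansion_mult Fexp has_fps_expansion_fps_expansion[of UNIV])
       (auto intro!: holomorphic_intros)
  have "(\<lambda>z. G z * E z) has_fps_expansion g * e"
    by (intro has_fps_expansion_mult Gexp Eexp)
  also have "(\<lambda>z. G z * E z) = F"
    by (simp add: G_def E_def mult.assoc flip: exp_add)
  finally have fge: "f = g * e" using Fexp fps_expansion_unique_complex by metis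
  have G1: "(\<lambda>z. G z - 1) has_fps_expansion (g - 1)"
    by (intro has_fps_expansion_diff Gexp) auto
  have g0: "fps_nth (g - 1) i = 0" if "i \<le> p" for i
    by (rule fps_nth_eq_0_if_small_on_ray[OF G1 _ that]) (use small in \<open>auto simp: G_def\<close>)
  have g': "fps_nth (fps_deriv g) i = 0" if "i < p" for i
    using g0[of "Suc i"] that by simp
  have f': "fps_deriv f = fps_deriv g * e + f * w'"
    unfolding fge by (simp add: e' algebra_simps)
  have w'nth: "fps_nth w' i = of_nat (Suc i) * coeff \<omega> (Suc i)" for i
    by (simp add: w'_def coeff_pderiv)
  have rec: "of_nat j * c j = (\<Sum>l=1..j. of_nat l * coeff \<omega> l * c (j - l))" if j: "1 \<le> j" "j \<le> p" for j
  proof -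
    define k where "k = j - 1"
    have jk: "j = Suc k" "k < p" using j by (auto simp: k_def)
    have "of_nat j * c j = fps_nth (fps_deriv f) k" by (simp add: jk f_def)
    also have "\<dots> = (\<Sum>i=0..k. fps_nth (fps_deriv g) i * fps_nth e (k - i)) + fps_nth (f * w') k"
      by (simp only: f' fps_add_nth fps_mult_nth)
    also have "(\<Sum>i=0..k. fps_nth (fps_deriv g) i * fps_nth e (k - i)) = 0"
      using jk by (intro sum.neutral) (auto simp del: fps_deriv_nth simp: g')
    also have "fps_nth (f * w') k = fps_nth (w' * f) k" by (simp add: mult.commute)
    also have "\<dots> = (\<Sum>i=0..k. of_nat (Suc i) * coeff \<omega> (Suc i) * c (k - i))"
      by (simp only: fps_mult_nth w'nth f_def fps_nth_Abs_fps)
    also have "\<dots> = (\<Sum>l=1..j. of_nat l * coeff \<omega> l * c (j - l))"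
      unfolding jk(1) One_nat_def sum.shift_bounds_cl_Suc_ivl by simp
    finally show ?thesis by simp
  qed
  have coeff_rec: "coeff \<omega> j = c j / c 0 - (\<Sum>l=1..j-1. of_nat l / of_nat j * (c (j - l) / c 0) * coeff \<omega> l)"
    if j: "1 \<le> j" "j \<le> p" for j
  proof -
    have "{1..j} = insert j {1..j-1}" using j by auto
    hence "of_nat j * c j = of_nat j * coeff \<omega> j * c 0 + (\<Sum>l=1..j-1. of_nat l * coeff \<omega> l * c (j - l))"
      using rec[OF j] j by simp
    hence "coeff \<omega> j = c j / c 0 - (\<Sum>l=1..j-1. of_nat l * coeff \<omega> l * c (j - l)) / (of_nat j * c 0)"
      using c0 j by (simp add: field_simps)
    also have "(\<Sum>l=1..j-1. of_nat l * coeff \<omega> l * c (j - l)) / (of_nat j * c 0) =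
        (\<Sum>l=1..j-1. of_nat l / of_nat j * (c (j - l) / c 0) * coeff \<omega> l)"
      unfolding sum_divide_distrib by (intro sum.cong refl) simp
    finally show ?thesis .
  qed
  from j show ?thesis
  proof (induction j rule: less_induct)
    case (less j)
    show ?case
    proof (cases "j = 1")
      case True
      thus ?thesis using b_1 coeff_rec[of 1] less.prems by simp
    next
      case False
      hence "b j = c j / c 0 - (\<Sum>l=1..j-1. of_nat l / of_nat j * (c (j - l) / c 0) * b l)"
        using less.prems by (intro b_rec) auto
      also have "\<dots> = c j / c 0 - (\<Sum>l=1..j-1. of_nat l / of_nat j * (c (j - l) / c 0) * coeff \<omega> l)"
        using less.prems less.IH by (intro arg_cong2[where f = "(-)"] refl sum.cong) auto
      also have "\<dots> = coeff \<omega> j" using coeff_rec[of j] less.prems by simp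
      finally show ?thesis .
    qed
  qed
qed

lemma ln_on_eq:
  assumes "z \<noteq> 0" "is_Arg z \<theta>" "\<theta> \<in> {x<..<y}" "y - x \<le> 2 * pi"
  shows "ln_on {x<..<y} z = of_real (ln (norm z)) + \<i> * of_real \<theta>"
proof -
  have "(THE \<theta>. \<theta> \<in> {x<..<y} \<and> is_Arg z \<theta>) = \<theta>"
  proof (rule the_equality)
    fix \<theta>' assume *: "\<theta>' \<in> {x<..<y} \<and> is_Arg z \<theta>'"
    show "\<theta>' = \<theta>"
      by (rule is_Arg_eqI[of z]) (use * assms in auto)
  qed (use assms in auto)
  thus ?thesis by (simp add: ln_on_def)
qed

text \<open>
  A sector of half-angle larger than \<open>\<pi>\<close> would contain every non-zero point.
\<close>
lemma sector_half_angle_le_pi: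
  assumes "z \<noteq> 0" "z \<notin> ray_sector \<psi> \<epsilon>"
  shows "\<epsilon> \<le> pi"
proof (rule ccontr)
  assume \<epsilon>: "\<not> \<epsilon> \<le> pi"
  define \<phi> where "\<phi> = Arg2pi (z * exp (- (\<i> * of_real (\<psi> - pi))))"
  have \<phi>: "0 \<le> \<phi>" "\<phi> < 2 * pi" "is_Arg (z * exp (- (\<i> * of_real (\<psi> - pi)))) \<phi>"
    using Arg2pi unfolding \<phi>_def by blast+
  have "is_Arg z (\<psi> - pi + \<phi>)"
  proof -
    have "z = z * exp (- (\<i> * of_real (\<psi> - pi))) * exp (\<i> * of_real (\<psi> - pi))"
      by (simp add: exp_minus)
    also have "z * exp (- (\<i> * of_real (\<psi> - pi))) = of_real (norm z) * exp (\<i> * of_real \<phi>)"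
      using \<phi>(3) by (simp add: is_Arg_def norm_mult)
    finally show ?thesis by (simp add: is_Arg_def distrib_left exp_add mult_ac)
  qed
  with assms \<epsilon> \<phi> show False by (auto simp: ray_sector_def)
qed

text \<open>
  A point outside the sector has an argument in \<open>[\<psi> - 2\<pi> + \<epsilon>, \<psi> - \<epsilon>]\<close>. Subtracting it from the midpoint \<open>\<psi> - \<pi>\<close> leaves at most
  \<open>\<pi> - \<epsilon>\<close> in absolute value, so \<open>\<tau>\<close> is the principal logarithm of \<open>-exp (\<i>\<psi>) / z\<close>.
\<close>
lemma ln_on_outside_sector:
  assumes z: "z \<noteq> 0" "z \<notin> ray_sector \<psi> \<epsilon>" and \<epsilon>: "\<epsilon> > 0"
  defines "\<tau> \<equiv> \<i> * of_real (\<psi> - pi) - ln_on {\<psi> - 2 * pi<..<\<psi>} z"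
  shows "Re \<tau> = - ln (norm z)" "\<bar>Im \<tau>\<bar> \<le> pi - \<epsilon>" "exp \<tau> = - (exp (\<i> * of_real \<psi>) / z)"
proof -
  define \<phi> where "\<phi> = Arg2pi (z * exp (- (\<i> * of_real \<psi>)))"
  have \<phi>: "0 \<le> \<phi>" "\<phi> < 2 * pi" "is_Arg (z * exp (- (\<i> * of_real \<psi>))) \<phi>"
    using Arg2pi unfolding \<phi>_def by blast+
  have arg: "is_Arg z (\<psi> + \<phi>)"
  proof -
    have "z = z * exp (- (\<i> * of_real \<psi>)) * exp (\<i> * of_real \<psi>)"
      by (simp add: exp_minus)
    also have "z * exp (- (\<i> * of_real \<psi>)) = of_real (norm z) * exp (\<i> * of_real \<phi>)"
      using \<phi>(3) by (simp add: is_Arg_def norm_mult)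
    finally show ?thesis by (simp add: is_Arg_def distrib_left exp_add mult_ac)
  qed
  have arg': "is_Arg z (\<psi> + \<phi> - 2 * pi)"
    using is_Arg_2pi_iff[of z "\<psi> + \<phi>" "-1"] arg by simp
  have 1: "\<phi> \<ge> \<epsilon>"
    using z arg \<phi>(1) \<epsilon> by (force simp: ray_sector_def)
  have 2: "\<phi> \<le> 2 * pi - \<epsilon>"
    using z arg' \<phi>(2) \<epsilon> by (force simp: ray_sector_def)
  have l: "ln_on {\<psi> - 2 * pi<..<\<psi>} z = of_real (ln (norm z)) + \<i> * of_real (\<psi> + \<phi> - 2 * pi)"
    by (rule ln_on_eq[OF z(1) arg']) (use 1 2 \<epsilon> in auto)
  have \<tau>: "\<tau> = - of_real (ln (norm z)) + \<i> * of_real (pi - \<phi>)"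
    unfolding \<tau>_def l by (simp add: algebra_simps)
  show "Re \<tau> = - ln (norm z)" unfolding \<tau> by simp
  show "\<bar>Im \<tau>\<bar> \<le> pi - \<epsilon>" unfolding \<tau> using 1 2 by simp
  have "exp (ln_on {\<psi> - 2 * pi<..<\<psi>} z) = z"
    unfolding l using arg' z by (simp add: exp_add exp_of_real is_Arg_def)
  thus "exp \<tau> = - (exp (\<i> * of_real \<psi>) / z)"
    by (simp add: \<tau>_def exp_diff right_diff_distrib)
qed

lemma convergence_exponent_nonneg:
  fixes r :: "nat \<Rightarrow> real"
  assumes lim: "filterlim r at_top sequentially"
    and alpha: "limsup (\<lambda>n. ereal (ln (real n) / ln (r n))) = ereal \<alpha>"
  shows "\<alpha> \<ge> 0"
proof -
  have "\<forall>\<^sub>F n in sequentially. r n > 1" using lim by (simp add: filterlim_at_top_dense)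
  hence "\<forall>\<^sub>F n in sequentially. 0 \<le> ereal (ln (real n) / ln (r n))"
    using eventually_gt_at_top[of 0]
    by eventually_elim (auto intro!: divide_nonneg_nonneg)
  from le_Limsup[OF _ this] have "0 \<le> ereal \<alpha>" by (simp add: alpha)
  thus ?thesis by simp
qed

text \<open>
  For \<open>\<alpha> < \<gamma> < \<beta>\<close>, eventually \<open>n \<le> r\<^sub>n powr \<gamma>\<close>, so \<open>r\<^sub>n powr (-\<beta>) \<le> n powr (-\<beta>/\<gamma>)\<close>, which is summable.
\<close>
lemma summable_beyond_convergence_exponent:
  fixes r :: "nat \<Rightarrow> real"
  assumes lim: "filterlim r at_top sequentially"
    and alpha: "limsup (\<lambda>n. ereal (ln (real n) / ln (r n))) = ereal \<alpha>"
    and \<beta>: "\<beta> > \<alpha>"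
  shows "summable (\<lambda>n. exp (- \<beta> * ln (r n)))"
proof -
  have \<alpha>0: "\<alpha> \<ge> 0" by (rule convergence_exponent_nonneg[OF lim alpha])
  define \<gamma> where "\<gamma> = (\<alpha> + \<beta>) / 2"
  have \<gamma>: "\<alpha> < \<gamma>" "\<gamma> < \<beta>" "\<gamma> > 0" using \<alpha>0 \<beta> by (auto simp: \<gamma>_def)
  have "\<forall>\<^sub>F n in sequentially. ereal (ln (real n) / ln (r n)) < ereal \<gamma>"
    by (rule Limsup_lessD) (use \<gamma> in \<open>simp add: alpha\<close>)
  moreover have "\<forall>\<^sub>F n in sequentially. r n > 1" using lim by (simp add: filterlim_at_top_dense)
  ultimately have ev: "\<forall>\<^sub>F n in sequentially. norm (exp (- \<beta> * ln (r n))) \<le> real n powr (- \<beta> / \<gamma>)"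
    using eventually_gt_at_top[of 0]
  proof eventually_elim
    case (elim n)
    hence "ln (real n) < \<gamma> * ln (r n)" by (simp add: divide_less_eq)
    hence "ln (real n) / \<gamma> \<le> ln (r n)" using \<gamma> by (simp add: field_simps)
    hence "\<beta> * (ln (real n) / \<gamma>) \<le> \<beta> * ln (r n)" using \<alpha>0 \<beta> by (intro mult_left_mono) auto
    thus ?case using elim by (simp add: powr_def)
  qed
  have "summable (\<lambda>n. real n powr (- \<beta> / \<gamma>))"
    unfolding summable_real_powr_iff using \<gamma> by (simp add: field_simps)
  thus ?thesis by (rule summable_comparison_test_ev[OF ev])
qed

section \<open>The zeta function as a transform\<close>

lemma norm_exp_minus_1_le:
  fixes w :: complex
  shows "norm (exp w - 1) \<le> norm w * exp (norm w)"
proof -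
  have "norm (exp w - exp 0) \<le> exp (norm w) * norm (w - 0)"
  proof (rule field_differentiable_bound[where S = "cball 0 (norm w)" and f' = exp])
    show "norm (exp z) \<le> exp (norm w)" if "z \<in> cball 0 (norm w)" for z :: complex
      using that norm_exp[of z] by (intro order_trans[OF norm_exp]) auto
  qed (auto intro!: derivative_eq_intros)
  thus ?thesis by (simp add: mult.commute)
qed

text \<open>
  The data of the theorem: sequence, characteristic function with its Taylor coefficients, branch of the
  logarithm, and coefficients of the expansion. The expansion itself is assumed where it is used, as its order varies.
\<close>
locale char_fun_setting =
  fixes a :: "nat \<Rightarrow> complex" and \<alpha> \<epsilon> \<psi> :: real
    and F L :: "complex \<Rightarrow> complex" and b c :: "nat \<Rightarrow> complex"
    and m :: nat and d :: "nat \<Rightarrow> nat \<Rightarrow> complex"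
  assumes a1_pos: "0 < norm (a 1)"
    and a_mono: "\<And>n. n \<ge> 1 \<Longrightarrow> norm (a n) \<le> norm (a (Suc n))"
    and a_unbounded: "filterlim (\<lambda>n. norm (a n)) at_top sequentially"
    and alpha: "limsup (\<lambda>n. ereal (ln (real n) / ln (norm (a n)))) = ereal \<alpha>"
    and eps: "\<epsilon> > 0"
    and a_sector: "\<And>n. n \<ge> 1 \<Longrightarrow> a n \<notin> ray_sector \<psi> \<epsilon>"
    and F_char: "min_order_char_fun a \<alpha> F"
    and F_series: "\<And>z. (\<lambda>j. c j * z ^ j) sums F z"
    and b_1: "b 1 = c 1 / c 0"
    and b_rec: "\<And>j. j \<ge> 2 \<Longrightarrow>
      b j = c j / c 0 - (\<Sum>l=1..j-1. of_nat l / of_nat j * (c (j - l) / c 0) * b l)"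
    and L_holo: "L holomorphic_on ray_sector \<psi> \<epsilon>"
    and L_log: "\<And>z. z \<in> ray_sector \<psi> \<epsilon> \<Longrightarrow> exp (L z) = F z"
    and m: "m \<ge> 1"
begin

definition genus :: nat where "genus = nat \<lfloor>\<alpha>\<rfloor>"

definition ray :: "real \<Rightarrow> complex" where "ray u = exp (of_real u + \<i> * of_real \<psi>)"

definition \<tau> :: "nat \<Rightarrow> complex" where
  "\<tau> n = \<i> * of_real (\<psi> - pi) - ln_on {\<psi> - 2 * pi<..<\<psi>} (a (Suc n))"

definition h :: "real \<Rightarrow> complex" where
  "h u = (\<Sum>n. genus_log genus (exp (of_real u + \<tau> n)))"

lemma alpha_nonneg: "0 \<le> \<alpha>"
  by (rule convergence_exponent_nonneg[OF a_unbounded alpha])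

lemma genus_bounds: "real genus \<le> \<alpha>" "\<alpha> < real genus + 1"
  using alpha_nonneg by (simp_all add: genus_def)

lemma a_nonzero: "a (Suc n) \<noteq> 0"
proof -
  have "norm (a 1) \<le> norm (a (Suc n))"
    by (induction n) (auto intro: order_trans[OF _ a_mono])
  with a1_pos show ?thesis by auto
qed

lemma eps_le_pi: "\<epsilon> \<le> pi"
  using sector_half_angle_le_pi[OF a_nonzero[of 0]] a_sector[of 1] by simp

lemma Re_\<tau>: "Re (\<tau> n) = - ln (norm (a (Suc n)))"
  and Im_\<tau>: "\<bar>Im (\<tau> n)\<bar> \<le> pi - \<epsilon>"
  and exp_\<tau>: "exp (\<tau> n) = - (exp (\<i> * of_real \<psi>) / a (Suc n))"
  using ln_on_outside_sector[OF a_nonzero a_sector eps, of n] unfolding \<tau>_def by auto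

lemma Im_\<tau>_pi: "\<bar>Im (\<tau> n)\<bar> \<le> pi" "\<bar>Im (\<tau> n)\<bar> < pi"
  using Im_\<tau>[of n] eps by auto

lemma summable_\<tau>: "\<beta> > \<alpha> \<Longrightarrow> summable (\<lambda>n. exp (\<beta> * Re (\<tau> n)))"
  using summable_beyond_convergence_exponent[OF a_unbounded alpha, of \<beta>]
  by (simp add: Re_\<tau> summable_Suc_iff[of "\<lambda>n. exp (- (\<beta> * ln (norm (a n))))"])

lemma summable_exp_\<tau>: "Re s > \<alpha> \<Longrightarrow> summable (\<lambda>n. exp (s * \<tau> n))"
  by (rule summable_exp_mult[OF Im_\<tau>_pi(1) summable_\<tau>])

lemma seq_zeta_eq:
  assumes s: "Re s > \<alpha>"
  shows "seq_zeta a \<psi> s = exp (s * (\<i> * of_real pi)) * exp (- s * (\<i> * of_real \<psi>)) * (\<Sum>n. exp (s * \<tau> n))"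
proof -
  have "pow_on {\<psi> - 2 * pi<..<\<psi>} (a (Suc n)) (- s) =
          exp (s * (\<i> * of_real pi)) * exp (- s * (\<i> * of_real \<psi>)) * exp (s * \<tau> n)" for n
    unfolding pow_on_def \<tau>_def by (simp add: algebra_simps flip: exp_add)
  thus ?thesis
    unfolding seq_zeta_def by (simp only: suminf_mult[OF summable_exp_\<tau>[OF s]])
qed

lemma seq_zeta_holomorphic: "seq_zeta a \<psi> holomorphic_on {s. Re s > \<alpha>}"
proof -
  have "(\<lambda>s. exp (s * (\<i> * of_real pi)) * exp (- s * (\<i> * of_real \<psi>)) * (\<Sum>n. exp (s * \<tau> n)))
          holomorphic_on {s. Re s > \<alpha>}"
    by (intro holomorphic_intros holomorphic_exp_series[OF Im_\<tau>_pi(1) summable_\<tau>])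
  thus ?thesis by (rule holomorphic_transform) (simp add: seq_zeta_eq)
qed

lemmas series_facts = eps eps_le_pi Im_\<tau> alpha_nonneg genus_bounds summable_\<tau>

lemma h_bound:
  assumes "\<alpha> < \<beta>" "\<beta> \<le> real genus + 1"
  obtains C where "\<And>u. norm (h u) \<le> C * exp (\<beta> * u)"
  using genus_log_series_bound[OF series_facts assms] unfolding h_def by blast

lemma isCont_h: "isCont h u"
  unfolding h_def by (rule isCont_genus_log_series[OF series_facts])

lemma h_laplace:
  assumes "\<alpha> < Re s" "Re s < real genus + 1"
  shows "(\<integral>u. exp (- s * of_real u) * h u \<partial>lborel) =
           (\<Sum>n. exp (s * \<tau> n)) * (of_real pi / (s * sin (of_real pi * s)))"
  unfolding h_def by (rule genus_log_series_mellin[OF series_facts assms])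

lemma exp_h: "exp (h u) = (\<Prod>n. weierstrass_factor genus (ray u / a (Suc n)))"
proof -
  have "weierstrass_factor genus (ray u / a (Suc n)) = exp (genus_log genus (exp (of_real u + \<tau> n)))" for n
  proof -
    have "1 + exp (of_real u + \<tau> n) \<noteq> 0"
      using one_plus_exp_slit[of "of_real u + \<tau> n"] Im_\<tau>_pi(2)[of n] by force
    moreover have "ray u / a (Suc n) = - exp (of_real u + \<tau> n)"
      by (simp add: ray_def exp_add exp_\<tau>)
    ultimately show ?thesis by (simp add: exp_genus_log)
  qed
  moreover have "summable (\<lambda>n. genus_log genus (exp (of_real u + \<tau> n)))"
    by (rule summable_norm_cancel[OF summable_genus_log_series[OF series_facts]])
  ultimately show ?thesis by (simp add: h_def prodinf_exp)
qed

lemma ray_nonzero: "ray u \<noteq> 0" and norm_ray: "norm (ray u) = exp u"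
  by (simp_all add: ray_def)

lemma is_Arg_ray: "is_Arg (ray u) \<psi>"
  unfolding is_Arg_def norm_ray by (simp add: ray_def exp_add exp_of_real)

lemma ray_in_sector: "ray u \<in> ray_sector \<psi> \<epsilon>"
  using ray_nonzero is_Arg_ray eps by (auto simp: ray_sector_def intro!: bexI[of _ \<psi>])

lemma ln_on_ray: "ln_on {\<psi> - \<epsilon><..<\<psi> + \<epsilon>} (ray u) = of_real u + \<i> * of_real \<psi>"
  by (subst ln_on_eq[OF ray_nonzero is_Arg_ray]) (use eps eps_le_pi in \<open>auto simp: norm_ray\<close>)


lemma continuous_on_L_ray: "continuous_on UNIV (\<lambda>u. L (ray u))"
proof (rule continuous_on_compose2[OF holomorphic_on_imp_continuous_on[OF L_holo]])
  show "continuous_on UNIV ray" unfolding ray_def by (intro continuous_intros)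
qed (use ray_in_sector in auto)

text \<open>
  On the ray, \<open>L - \<omega> - h\<close> is continuous with exponential 1, hence a constant; the particular branch \<open>L\<close> enters only
  through this constant. As \<open>h\<close> is \<open>O(z^(p+1))\<close> at the origin, \<open>\<omega>\<close> contains the Taylor coefficients of \<open>ln F\<close> up to index \<open>p\<close>.
\<close>
lemma L_ray_decomposition:
  obtains \<omega> \<kappa> where "degree \<omega> \<le> genus"
    "\<And>u. L (ray u) = poly \<omega> (ray u) + h u + \<kappa>"
    "\<And>j. 1 \<le> j \<Longrightarrow> j \<le> genus \<Longrightarrow> b j = coeff \<omega> j"
proof -
  obtain \<omega> where deg: "degree \<omega> \<le> genus" and
    F: "\<And>z. F z = exp (poly \<omega> z) * (\<Prod>n. weierstrass_factor genus (z / a (Suc n)))"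
    using F_char unfolding min_order_char_fun_def genus_def by blast
  have F_ray: "F (ray u) = exp (poly \<omega> (ray u) + h u)" for u
    unfolding F exp_add exp_h by simp
  define g where "g = (\<lambda>u. L (ray u) - poly \<omega> (ray u) - h u)"
  have exp_g: "exp (g u) = 1" for u
    unfolding g_def by (simp add: exp_diff L_log[OF ray_in_sector] F_ray exp_add)
  have "g constant_on UNIV"
  proof (rule continuous_discrete_range_constant)
    show "continuous_on UNIV g"
      unfolding g_def
    proof (intro continuous_on_diff continuous_on_L_ray)
      show "continuous_on UNIV (\<lambda>u. poly \<omega> (ray u))" unfolding ray_def by (intro continuous_intros)
      show "continuous_on UNIV h"
        by (intro continuous_at_imp_continuous_on ballI isCont_h)
    qed
    fix x :: real
    \<comment> \<open>distinct values of \<open>g\<close> are distinct integer multiples of \<open>2\<pi>\<i>\<close>\<close>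
    have "2 * pi \<le> norm (g y - g x)" if "g y \<noteq> g x" for y
    proof -
      from exp_g[of x] exp_g[of y] have "exp (g y - g x) = 1" by (simp add: exp_diff)
      then obtain n :: int where n: "Re (g y - g x) = 0" "Im (g y - g x) = of_int (2 * n) * pi"
        unfolding exp_eq_1 by blast
      have "n \<noteq> 0" using n that by (auto simp: complex_eq_iff)
      hence "1 \<le> \<bar>real_of_int n\<bar>" by linarith
      hence "2 * pi \<le> \<bar>Im (g y - g x)\<bar>" unfolding n by (simp add: abs_mult)
      thus ?thesis using abs_Im_le_cmod[of "g y - g x"] by linarith
    qed
    thus "\<exists>e>0. \<forall>y. y \<in> UNIV \<and> g y \<noteq> g x \<longrightarrow> e \<le> norm (g y - g x)"
      by (intro exI[of _ "2 * pi"]) auto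
  qed auto
  then obtain \<kappa> where \<kappa>: "\<And>u. g u = \<kappa>" by (auto simp: constant_on_def)
  have c0: "c 0 \<noteq> 0"
  proof -
    have "(\<lambda>j. c j * 0 ^ j) sums c 0" by (rule powser_sums_zero)
    hence "F 0 = c 0" using F_series[of 0] by (rule sums_unique2[symmetric])
    hence "exp (poly \<omega> 0) = c 0" by (simp add: F)
    thus ?thesis by (metis exp_not_eq_zero)
  qed
  obtain C where C: "\<And>u. norm (h u) \<le> C * exp ((real genus + 1) * u)"
    using h_bound[of "real genus + 1"] genus_bounds by auto
  have C0: "0 \<le> C" using order_trans[OF norm_ge_zero C[of 0]] by simp
  have small: "norm (F (exp (of_real u + \<i> * of_real \<psi>)) *
        exp (- poly \<omega> (exp (of_real u + \<i> * of_real \<psi>))) - 1) \<le> (C * exp C) * exp ((real genus + 1) * u)"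
    if u: "u < 0" for u
  proof -
    have hC: "norm (h u) \<le> C"
    proof -
      have "norm (h u) \<le> C * exp ((real genus + 1) * u)" by (rule C)
      also have "\<dots> \<le> C * 1" using u C0 by (intro mult_left_mono) (auto intro: mult_nonneg_nonpos)
      finally show ?thesis by simp
    qed
    have "F (ray u) * exp (- poly \<omega> (ray u)) = exp (h u)"
      by (simp add: F_ray flip: exp_add)
    hence "norm (F (ray u) * exp (- poly \<omega> (ray u)) - 1) \<le> norm (h u) * exp (norm (h u))"
      by (simp add: norm_exp_minus_1_le)
    also have "\<dots> \<le> (C * exp ((real genus + 1) * u)) * exp C"
      using hC C C0 by (intro mult_mono) auto
    finally show ?thesis by (simp add: ray_def mult_ac)
  qed
  have b: "b j = coeff \<omega> j" if "1 \<le> j" "j \<le> genus" for j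
    by (rule log_coefficients_unique[OF F_series c0 small b_1 b_rec that])
  show ?thesis
    by (rule that[OF deg _ b]) (use \<kappa> in \<open>auto simp: g_def algebra_simps\<close>)
qed

text \<open>
  The terms \<open>q z^\<beta> (ln z)^k\<close> of \<open>h\<close> near infinity are indexed by a disjoint sum: a left element \<open>(j, k)\<close> stands for a term of the
  given expansion of \<open>L\<close>, a right element \<open>j\<close> for the power \<open>z^j\<close> in \<open>-\<omega>\<close>. The unknown constants of \<open>\<omega>\<close> and of
  the branch are collected in the coefficient \<open>e\<close> of \<open>z^0\<close>, which can produce a pole only at \<open>s = 0\<close>.
\<close>
definition pole_index :: "nat \<Rightarrow> nat \<Rightarrow> (nat \<times> nat + nat) set" where
  "pole_index N M = ({0..N} \<times> {0..M}) <+> {0..genus}"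

definition pole_coeff :: "complex \<Rightarrow> nat \<times> nat + nat \<Rightarrow> complex" where
  "pole_coeff e = case_sum (\<lambda>(j, k). d j k) (\<lambda>j. if j = 0 then e else - b j)"

definition pole_point :: "nat \<times> nat + nat \<Rightarrow> real" where
  "pole_point = case_sum (\<lambda>(j, k). \<alpha> - real j / real m) real"

text \<open>
  The exponent of the logarithm in a term; the pole it produces has order one more.
\<close>
definition log_power :: "nat \<times> nat + nat \<Rightarrow> nat" where
  "log_power = case_sum snd (\<lambda>_. 0)"

lemma sum_pole_index:
  "(\<Sum>i\<in>pole_index N M. f i) = (\<Sum>j=0..N. \<Sum>k=0..M. f (Inl (j, k))) + (\<Sum>j=0..genus. f (Inr j))"
  unfolding pole_index_def by (subst sum.Plus) (simp_all add: sum.cartesian_product o_def case_prod_unfold)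

lemma finite_pole_index: "finite (pole_index N M)"
  by (simp add: pole_index_def)

lemma pole_point_le: "i \<in> pole_index N M \<Longrightarrow> pole_point i \<le> \<alpha>"
  using genus_bounds by (auto simp: pole_index_def pole_point_def)

lemma poly_ray:
  assumes "degree \<omega> \<le> genus"
  shows "poly \<omega> (ray u) = (\<Sum>j=0..genus. coeff \<omega> j * exp (of_nat j * (of_real u + \<i> * of_real \<psi>)))"
proof -
  have "poly \<omega> (ray u) = (\<Sum>j\<le>genus. coeff \<omega> j * ray u ^ j)"
    unfolding poly_altdef using assms by (intro sum.mono_neutral_left) (auto simp: coeff_eq_0)
  thus ?thesis by (simp add: ray_def exp_of_nat_mult atLeast0AtMost)
qed

text \<open>
  The asymptotic error bound holds for large \<open>u\<close>; on the remaining compact interval it holds by continuity.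
\<close>
lemma expansion_on_ray:
  assumes exp: "log_expansion L \<psi> \<epsilon> \<alpha> m d N M \<delta>"
  obtains D where "\<And>u. u \<ge> 0 \<Longrightarrow>
    norm (L (ray u) - (\<Sum>j=0..N. \<Sum>k=0..M.
       d j k * exp (of_real (\<alpha> - real j / real m) * (of_real u + \<i> * of_real \<psi>)) * (of_real u + \<i> * of_real \<psi>) ^ k))
      \<le> D * exp ((\<alpha> - real N / real m - \<delta>) * u)"
proof -
  define \<eta> where "\<eta> = \<alpha> - real N / real m - \<delta>"
  define R where "R = (\<lambda>u. L (ray u) - (\<Sum>j=0..N. \<Sum>k=0..M.
       d j k * exp (of_real (\<alpha> - real j / real m) * (of_real u + \<i> * of_real \<psi>)) * (of_real u + \<i> * of_real \<psi>) ^ k))"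
  let ?T = "{\<psi> - \<epsilon><..<\<psi> + \<epsilon>}"
  have "filterlim ray (inf at_infinity (principal (ray_sector \<psi> \<epsilon>))) at_top"
    unfolding filterlim_inf
  proof
    have "filterlim (\<lambda>u. norm (ray u)) at_top at_top" unfolding norm_ray by (rule exp_at_top)
    thus "filterlim ray at_infinity at_top" by (rule filterlim_norm_at_top_imp_at_infinity)
    show "filterlim ray (principal (ray_sector \<psi> \<epsilon>)) at_top"
      by (simp add: filterlim_principal ray_in_sector)
  qed
  moreover have "\<forall>\<^sub>F z in inf at_infinity (principal (ray_sector \<psi> \<epsilon>)).
     norm (L z - (\<Sum>j=0..N. \<Sum>k=0..M. d j k * pow_on ?T z (of_real (\<alpha> - real j / real m)) * ln_on ?T z ^ k))
       \<le> 1 * norm (pow_on ?T z (of_real \<eta>))"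
    using exp unfolding log_expansion_def Let_def \<eta>_def by (rule landau_o.smallD) simp
  ultimately have "\<forall>\<^sub>F u in at_top.
     norm (L (ray u) - (\<Sum>j=0..N. \<Sum>k=0..M. d j k * pow_on ?T (ray u) (of_real (\<alpha> - real j / real m)) * ln_on ?T (ray u) ^ k))
       \<le> 1 * norm (pow_on ?T (ray u) (of_real \<eta>))"
    by (rule eventually_compose_filterlim[rotated])
  hence "\<forall>\<^sub>F u in at_top. norm (R u) \<le> exp (\<eta> * u)"
    by eventually_elim (simp add: R_def pow_on_def ln_on_ray)
  then obtain B where B: "\<And>u. u \<ge> B \<Longrightarrow> norm (R u) \<le> exp (\<eta> * u)"
    by (auto simp: eventually_at_top_linorder)
  have "continuous_on {0..B} (\<lambda>u. norm (R u) * exp (- \<eta> * u))"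
    unfolding R_def by (intro continuous_intros continuous_on_subset[OF continuous_on_L_ray]) auto
  hence "bounded ((\<lambda>u. norm (R u) * exp (- \<eta> * u)) ` {0..B})"
    by (intro compact_imp_bounded compact_continuous_image) auto
  then obtain D where D: "\<And>u. u \<in> {0..B} \<Longrightarrow> \<bar>norm (R u) * exp (- \<eta> * u)\<bar> \<le> D"
    unfolding bounded_iff real_norm_def by blast
  have "norm (R u) \<le> max D 1 * exp (\<eta> * u)" if u: "u \<ge> 0" for u
  proof (cases "u \<ge> B")
    case True
    have "norm (R u) \<le> 1 * exp (\<eta> * u)" using B[OF True] by simp
    also have "\<dots> \<le> max D 1 * exp (\<eta> * u)" by (intro mult_right_mono) auto
    finally show ?thesis .
  next
    case False
    hence "norm (R u) * exp (- \<eta> * u) \<le> max D 1" using D[of u] u by auto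
    hence "norm (R u) * exp (- \<eta> * u) * exp (\<eta> * u) \<le> max D 1 * exp (\<eta> * u)"
      by (intro mult_right_mono) auto
    thus ?thesis by (simp add: mult.assoc flip: exp_add)
  qed
  thus ?thesis unfolding R_def \<eta>_def by (rule that)
qed

definition mellin_factor :: "complex \<Rightarrow> complex" where
  "mellin_factor s = s * sin (of_real pi * s) * exp (s * (\<i> * of_real pi)) / of_real pi"

text \<open>
  On \<open>\<alpha> < Re s < p + 1\<close> the series for the zeta function and the transform of \<open>h\<close> both converge. The right-hand side
  makes sense on the larger strip reaching down to \<open>\<alpha> - N/m - \<delta>\<close>.
\<close>
lemma zeta_on_strip:
  assumes exp: "log_expansion L \<psi> \<epsilon> \<alpha> m d N M \<delta>" and \<delta>: "\<delta> > 0"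
  obtains H e where
    "H holomorphic_on {s. \<alpha> - real N / real m - \<delta> < Re s \<and> Re s < real genus + 1}"
    "\<And>s. \<alpha> < Re s \<Longrightarrow> Re s < real genus + 1 \<Longrightarrow>
       seq_zeta a \<psi> s = mellin_factor s *
         (H s + (\<Sum>i\<in>pole_index N M. pole_coeff e i *
             (fact (log_power i) / (s - of_real (pole_point i)) ^ Suc (log_power i))))"
proof -
  define \<eta> where "\<eta> = \<alpha> - real N / real m - \<delta>"
  have "\<eta> \<le> \<alpha>"
    unfolding \<eta>_def using \<delta> divide_nonneg_nonneg[of "real N" "real m"] by linarith
  obtain \<omega> \<kappa> where \<omega>: "degree \<omega> \<le> genus" and L: "\<And>u. L (ray u) = poly \<omega> (ray u) + h u + \<kappa>"
    and b: "\<And>j. 1 \<le> j \<Longrightarrow> j \<le> genus \<Longrightarrow> b j = coeff \<omega> j"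
    using L_ray_decomposition by blast
  \<comment> \<open>coefficient of \<open>z^0\<close> in \<open>h\<close> coming from \<open>\<omega>\<close> and from the branch of the logarithm\<close>
  define e where "e = - (coeff \<omega> 0 + \<kappa>)"
  obtain D where D: "\<And>u. u \<ge> 0 \<Longrightarrow>
    norm (L (ray u) - (\<Sum>j=0..N. \<Sum>k=0..M.
       d j k * exp (of_real (\<alpha> - real j / real m) * (of_real u + \<i> * of_real \<psi>)) * (of_real u + \<i> * of_real \<psi>) ^ k))
      \<le> D * exp (\<eta> * u)"
    using expansion_on_ray[OF exp] unfolding \<eta>_def by blast
  obtain C where C: "\<And>u. norm (h u) \<le> C * exp ((real genus + 1) * u)"
    using h_bound[of "real genus + 1"] genus_bounds by auto
  have right: "norm (h u - (\<Sum>i\<in>pole_index N M. pole_coeff e i *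
          exp (of_real (pole_point i) * (of_real u + \<i> * of_real \<psi>)) * (of_real u + \<i> * of_real \<psi>) ^ log_power i))
          \<le> D * exp (\<eta> * u)" if u: "u \<ge> 0" for u
  proof -
    let ?v = "of_real u + \<i> * of_real \<psi>"
    have "(\<Sum>j=0..genus. (if j = 0 then e else - b j) * exp (of_nat j * ?v)) =
          - (\<Sum>j=0..genus. coeff \<omega> j * exp (of_nat j * ?v)) - \<kappa>"
    proof -
      have "(\<Sum>j=0..genus. (if j = 0 then e else - b j) * exp (of_nat j * ?v)) =
            (\<Sum>j=0..genus. - (coeff \<omega> j * exp (of_nat j * ?v)) + (if j = 0 then - \<kappa> else 0))"
        by (intro sum.cong) (auto simp: e_def b)
      thus ?thesis by (simp add: sum_subtractf)
    qed
    also have "\<dots> = h u - L (ray u)" by (simp add: L poly_ray[OF \<omega>])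
    finally have "h u - (\<Sum>i\<in>pole_index N M. pole_coeff e i *
          exp (of_real (pole_point i) * ?v) * ?v ^ log_power i) =
        L (ray u) - (\<Sum>j=0..N. \<Sum>k=0..M. d j k * exp (of_real (\<alpha> - real j / real m) * ?v) * ?v ^ k)"
      unfolding sum_pole_index by (simp add: pole_coeff_def pole_point_def log_power_def)
    thus ?thesis using D[OF u] by simp
  qed
  have h_meas: "h \<in> borel_measurable borel"
    by (intro borel_measurable_continuous_onI continuous_at_imp_continuous_on ballI isCont_h)
  obtain H where H: "H holomorphic_on {s. \<eta> < Re s \<and> Re s < real genus + 1}"
    "\<And>s. \<alpha> < Re s \<Longrightarrow> Re s < real genus + 1 \<Longrightarrow>
        exp (- s * (\<i> * of_real \<psi>)) * (\<integral>u. exp (- s * of_real u) * h u \<partial>lborel) =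
        H s + (\<Sum>i\<in>pole_index N M. pole_coeff e i * (fact (log_power i) / (s - of_real (pole_point i)) ^ Suc (log_power i)))"
    by (rule laplace_continuation[OF h_meas finite_pole_index pole_point_le[of _ N M] \<open>\<eta> \<le> \<alpha>\<close> C right]) blast+
  show ?thesis
  proof (rule that)
    show "H holomorphic_on {s. \<alpha> - real N / real m - \<delta> < Re s \<and> Re s < real genus + 1}"
      using H(1) by (simp add: \<eta>_def)
    fix s assume s: "\<alpha> < Re s" "Re s < real genus + 1"
    have nz: "s \<noteq> 0" "sin (of_real pi * s) \<noteq> 0"
      using s alpha_nonneg genus_bounds sin_pi_nonzero[of genus s] by auto
    have "mellin_factor s * (exp (- s * (\<i> * of_real \<psi>)) * (\<integral>u. exp (- s * of_real u) * h u \<partial>lborel)) =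
          seq_zeta a \<psi> s"
      unfolding h_laplace[OF s] seq_zeta_eq[OF s(1)] mellin_factor_def using nz
      by simp
    thus "seq_zeta a \<psi> s = mellin_factor s *
         (H s + (\<Sum>i\<in>pole_index N M. pole_coeff e i *
             (fact (log_power i) / (s - of_real (pole_point i)) ^ Suc (log_power i))))"
      unfolding H(2)[OF s] by simp
  qed
qed

end

section \<open>Meromorphic continuation and values at integers\<close>

lemma nicely_meromorphic_eqI:
  assumes Z1: "Z1 nicely_meromorphic_on U" and Z2: "Z2 nicely_meromorphic_on U"
    and z: "z \<in> U" and ev: "eventually (\<lambda>w. Z1 w = Z2 w) (at z)"
  shows "Z1 z = Z2 z"
proof -
  have pole: "is_pole Z1 z \<longleftrightarrow> is_pole Z2 z"
    by (rule is_pole_cong[OF ev refl])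
  have lim: "Z1 \<midarrow>z\<rightarrow> l \<longleftrightarrow> Z2 \<midarrow>z\<rightarrow> l" for l
    by (rule filterlim_cong[OF refl refl ev])
  have 1: "(is_pole Z1 z \<and> Z1 z = 0) \<or> Z1 \<midarrow>z\<rightarrow> Z1 z"
    using Z1 z by (auto simp: nicely_meromorphic_on_def)
  have 2: "(is_pole Z2 z \<and> Z2 z = 0) \<or> Z2 \<midarrow>z\<rightarrow> Z2 z"
    using Z2 z by (auto simp: nicely_meromorphic_on_def)
  have no: "\<not> (is_pole Z1 z \<and> Z1 \<midarrow>z\<rightarrow> l)" for l
    unfolding is_pole_def using not_tendsto_and_filterlim_at_infinity[of "at z" Z1 l] by auto
  show ?thesis
    using 1 2 pole lim no tendsto_unique[of "at z" Z1] by (metis at_neq_bot)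
qed

lemma meromorphic_identity:
  assumes Z1: "Z1 meromorphic_on U" and Z2: "Z2 meromorphic_on U"
    and U: "open U" "connected U"
    and W: "open W" "W \<subseteq> U" "w \<in> W" and eq: "\<And>s. s \<in> W \<Longrightarrow> Z1 s = Z2 s" and z: "z \<in> U"
  shows "eventually (\<lambda>s. Z1 s = Z2 s) (at z)"
proof -
  have "(\<lambda>s. Z1 s - Z2 s) meromorphic_on U" by (intro meromorphic_intros Z1 Z2)
  from meromorphic_imp_constant_or_avoid[OF this U, of 0]
  have "(\<forall>\<^sub>\<approx>s\<in>U. Z1 s = Z2 s) \<or> (\<forall>\<^sub>\<approx>s\<in>U. Z1 s \<noteq> Z2 s)" by simp
  moreover have "\<not> (\<forall>\<^sub>\<approx>s\<in>U. Z1 s \<noteq> Z2 s)"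
  proof
    assume "\<forall>\<^sub>\<approx>s\<in>U. Z1 s \<noteq> Z2 s"
    hence "eventually (\<lambda>s. Z1 s \<noteq> Z2 s) (at w)"
      using W U by (auto simp: eventually_cosparse_open_eq)
    moreover have "eventually (\<lambda>s. s \<in> W) (at w)"
      using W by (intro eventually_at_in_open') auto
    ultimately have "eventually (\<lambda>s. False) (at w)"
      by eventually_elim (use eq in auto)
    thus False by simp
  qed
  ultimately show ?thesis using z U by (auto simp: eventually_cosparse_open_eq)
qed

text \<open>
  A principal part with a finite limit vanishes: a non-constant polynomial in \<open>1/(s - z)\<close> tends to infinity.
\<close>
lemma poly_inverse_bounded_imp_constant:
  fixes P :: "complex poly"
  assumes "((\<lambda>s. poly P (1 / (s - z))) \<longlongrightarrow> l) (at z)"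
  shows "l = coeff P 0"
proof -
  have "filterlim (\<lambda>s. s - z) (at 0) (at z)"
    unfolding filterlim_at by (auto intro!: tendsto_eq_intros simp: eventually_at_filter)
  from filterlim_compose[OF filterlim_inverse_at_infinity this]
  have lim: "filterlim (\<lambda>s. 1 / (s - z)) at_infinity (at z)" by (simp add: divide_inverse)
  have "degree P = 0"
  proof (rule ccontr)
    assume "degree P \<noteq> 0"
    hence "filterlim (poly P) at_infinity at_infinity"
      by (intro filterlim_poly_at_infinity) auto
    from filterlim_compose[OF this lim]
    have "filterlim (\<lambda>s. poly P (1 / (s - z))) at_infinity (at z)" .
    with assms show False
      using not_tendsto_and_filterlim_at_infinity[of "at z"] by auto
  qed
  then obtain x where x: "P = [:x:]" by (rule degree_eq_zeroE)
  with assms have "((\<lambda>s. x) \<longlongrightarrow> l) (at z)" by simp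
  hence "x = l" by (simp add: tendsto_const_iff)
  thus ?thesis by (simp add: x)
qed

text \<open>
  Dividing by \<open>T\<close>, \<open>H\<close> and the terms with \<open>\<beta>\<^sub>i \<noteq> z\<close> contribute \<open>s - z\<close> times a continuous function. The other terms form a
  polynomial in \<open>1/(s - z)\<close>, which has a finite limit because \<open>Z\<close> is continuous at \<open>z\<close>; hence it is constant, equal to its
  constant coefficient.
\<close>
lemma value_at_regular_point:
  fixes q :: "'i \<Rightarrow> complex" and \<beta> :: "'i \<Rightarrow> real" and k :: "'i \<Rightarrow> nat"
  assumes I: "finite I" and T: "isCont T z" "T z \<noteq> 0" and H: "isCont H z" and Z: "isCont Z z"
    and eq: "eventually (\<lambda>s. Z s = (s - z) * T s *
          (H s + (\<Sum>i\<in>I. q i * (fact (k i) / (s - of_real (\<beta> i)) ^ Suc (k i))))) (at z)"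
  shows "Z z = T z * (\<Sum>i\<in>{i\<in>I. of_real (\<beta> i) = z \<and> k i = 0}. q i)"
proof -
  define A where "A = {i\<in>I. of_real (\<beta> i) = z}"
  define G where "G = (\<lambda>s. H s + (\<Sum>i\<in>I - A. q i * (fact (k i) / (s - of_real (\<beta> i)) ^ Suc (k i))))"
  have fA: "finite A" "A \<subseteq> I" using I by (auto simp: A_def)
  have G: "isCont G z"
    unfolding G_def by (intro continuous_intros H) (auto simp: A_def)
  define P where "P = (\<Sum>i\<in>A. monom (q i * fact (k i)) (k i))"
  have "((\<lambda>s. Z s / T s - (s - z) * G s) \<longlongrightarrow> Z z / T z - (z - z) * G z) (at z)"
    using Z T G unfolding isCont_def by (intro tendsto_intros) auto
  moreover have "eventually (\<lambda>s. Z s / T s - (s - z) * G s = poly P (1 / (s - z))) (at z)"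
  proof -
    have "eventually (\<lambda>s. T s \<noteq> 0) (at z)"
      using T unfolding isCont_def by (rule tendsto_imp_eventually_ne)
    moreover have "eventually (\<lambda>s. s \<noteq> z) (at z)" by (simp add: eventually_at_filter)
    ultimately show ?thesis using eq
    proof eventually_elim
      case (elim s)
      have "(\<Sum>i\<in>I. q i * (fact (k i) / (s - of_real (\<beta> i)) ^ Suc (k i))) =
            (\<Sum>i\<in>I - A. q i * (fact (k i) / (s - of_real (\<beta> i)) ^ Suc (k i))) +
            (\<Sum>i\<in>A. q i * (fact (k i) / (s - of_real (\<beta> i)) ^ Suc (k i)))"
        by (rule sum.subset_diff[OF fA(2) I])
      also have "(\<Sum>i\<in>A. q i * (fact (k i) / (s - of_real (\<beta> i)) ^ Suc (k i))) =
          (\<Sum>i\<in>A. q i * (fact (k i) / (s - z) ^ Suc (k i)))"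
        by (intro sum.cong) (auto simp: A_def)
      finally have "H s + (\<Sum>i\<in>I. q i * (fact (k i) / (s - of_real (\<beta> i)) ^ Suc (k i))) =
          G s + (\<Sum>i\<in>A. q i * (fact (k i) / (s - z) ^ Suc (k i)))"
        by (simp only: G_def add.assoc)
      with elim(3) have "Z s = (s - z) * T s * (G s + (\<Sum>i\<in>A. q i * (fact (k i) / (s - z) ^ Suc (k i))))"
        by simp
      hence "Z s / T s = (s - z) * (G s + (\<Sum>i\<in>A. q i * (fact (k i) / (s - z) ^ Suc (k i))))"
        using elim(1) by simp
      hence "Z s / T s = (s - z) * G s + (s - z) * (\<Sum>i\<in>A. q i * (fact (k i) / (s - z) ^ Suc (k i)))"
        by (simp only: distrib_left)
      also have "(s - z) * (\<Sum>i\<in>A. q i * (fact (k i) / (s - z) ^ Suc (k i))) = poly P (1 / (s - z))"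
        unfolding P_def poly_sum sum_distrib_left
        using elim by (intro sum.cong) (auto simp: poly_monom power_divide)
      finally show ?case by simp
    qed
  qed
  ultimately have "((\<lambda>s. poly P (1 / (s - z))) \<longlongrightarrow> Z z / T z - (z - z) * G z) (at z)"
    by (rule Lim_transform_eventually)
  hence "Z z / T z = coeff P 0"
    using poly_inverse_bounded_imp_constant by fastforce
  also have "\<dots> = (\<Sum>i\<in>A. if k i = 0 then q i else 0)"
    unfolding P_def coeff_sum by (intro sum.cong) (auto simp: coeff_monom)
  also have "\<dots> = (\<Sum>i\<in>{i\<in>A. k i = 0}. q i)"
    by (rule sum.inter_filter[symmetric, OF fA(1)])
  also have "{i\<in>A. k i = 0} = {i\<in>I. of_real (\<beta> i) = z \<and> k i = 0}" by (auto simp: A_def)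
  finally show ?thesis using T by (simp add: field_simps)
qed

context char_fun_setting
begin

abbreviation "strip \<eta> \<equiv> {s. \<eta> < Re s \<and> Re s < real genus + 1}"

lemma open_strip: "open (strip \<eta>)"
  by (intro open_Collect_conj open_halfspace_Re_gt open_halfspace_Re_lt)

lemma connected_strip: "connected (strip \<eta>)"
proof -
  have "strip \<eta> = {s. Re s > \<eta>} \<inter> {s. Re s < real genus + 1}" by auto
  thus ?thesis by (auto intro!: convex_connected convex_Int convex_halfspace_Re_gt convex_halfspace_Re_lt)
qed

text \<open>
  It suffices to find a meromorphic continuation; removing the removable singularities makes it nicely
  meromorphic and does not change it where it is the holomorphic zeta series.
\<close>
lemma zeta_continuationI:
  assumes U: "open U" "{s. Re s > \<alpha>} \<subseteq> U" and Z0: "Z0 meromorphic_on U"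
    and eq: "\<And>s. Re s > \<alpha> \<Longrightarrow> Z0 s = seq_zeta a \<psi> s"
  shows "\<exists>Z. zeta_continuation a \<psi> \<alpha> U Z"
proof (intro exI)
  have hol: "Z0 holomorphic_on {s. Re s > \<alpha>}"
    by (rule holomorphic_transform[OF seq_zeta_holomorphic]) (simp add: eq)
  have "remove_sings Z0 s = seq_zeta a \<psi> s" if "Re s > \<alpha>" for s
  proof -
    have "Z0 analytic_on {s}"
      using hol that open_halfspace_Re_gt[of \<alpha>] by (auto simp: analytic_at)
    thus ?thesis using eq[OF that] by simp
  qed
  thus "zeta_continuation a \<psi> \<alpha> U (remove_sings Z0)"
    using remove_sings_nicely_meromorphic[OF Z0] by (simp add: zeta_continuation_def)
qed

lemma meromorphic_strip_formula:
  assumes H: "H holomorphic_on strip \<eta>"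
  shows "(\<lambda>s. mellin_factor s *
         (H s + (\<Sum>i\<in>pole_index N M. pole_coeff e i *
             (fact (log_power i) / (s - of_real (pole_point i)) ^ Suc (log_power i))))) meromorphic_on strip \<eta>"
proof -
  have "mellin_factor holomorphic_on UNIV"
    unfolding mellin_factor_def by (intro holomorphic_intros) auto
  hence "mellin_factor analytic_on UNIV" by (simp add: analytic_on_open)
  hence 1: "mellin_factor meromorphic_on strip \<eta>"
    by (rule analytic_on_imp_meromorphic_on[OF analytic_on_subset]) auto
  have 2: "H meromorphic_on strip \<eta>"
    using H by (simp add: analytic_on_imp_meromorphic_on analytic_on_open open_strip)
  show ?thesis by (intro meromorphic_intros 1 2)
qed

text \<open>
  The strip formula is only available for \<open>Re s < p + 1\<close>; it is glued to the zeta series along the overlap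
  \<open>\<alpha> < Re s < p + 1\<close>.
\<close>
lemma zeta_continuation_exists:
  assumes exp: "log_expansion L \<psi> \<epsilon> \<alpha> m d N M \<delta>" and \<delta>: "\<delta> > 0"
  shows "\<exists>Z. zeta_continuation a \<psi> \<alpha> {s. Re s > \<alpha> - real N / real m - \<delta>} Z"
proof -
  define \<eta> where "\<eta> = \<alpha> - real N / real m - \<delta>"
  have \<eta>: "\<eta> \<le> \<alpha>"
    unfolding \<eta>_def using \<delta> divide_nonneg_nonneg[of "real N" "real m"] by linarith
  obtain H e where H: "H holomorphic_on strip \<eta>"
    and eq: "\<And>s. \<alpha> < Re s \<Longrightarrow> Re s < real genus + 1 \<Longrightarrow>
       seq_zeta a \<psi> s = mellin_factor s *
         (H s + (\<Sum>i\<in>pole_index N M. pole_coeff e i *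
             (fact (log_power i) / (s - of_real (pole_point i)) ^ Suc (log_power i))))"
    using zeta_on_strip[OF exp \<delta>] unfolding \<eta>_def by blast
  define \<Phi> where "\<Phi> = (\<lambda>s. mellin_factor s *
         (H s + (\<Sum>i\<in>pole_index N M. pole_coeff e i *
             (fact (log_power i) / (s - of_real (pole_point i)) ^ Suc (log_power i)))))"
  define Z0 where "Z0 = (\<lambda>s. if Re s > \<alpha> then seq_zeta a \<psi> s else \<Phi> s)"
  have "Z0 meromorphic_on {s. Re s > \<alpha>} \<union> strip \<eta>"
  proof (rule meromorphic_on_Un)
    have "Z0 holomorphic_on {s. Re s > \<alpha>}"
      by (rule holomorphic_transform[OF seq_zeta_holomorphic]) (simp add: Z0_def)
    thus "Z0 meromorphic_on {s. Re s > \<alpha>}"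
      by (simp add: analytic_on_imp_meromorphic_on analytic_on_open open_halfspace_Re_gt)
    have ev: "eventually (\<lambda>w. Z0 w = \<Phi> w) (at z)" if "z \<in> strip \<eta>" for z
    proof -
      have "eventually (\<lambda>w. w \<in> strip \<eta>) (at z)"
        using that open_strip by (intro eventually_at_in_open') auto
      thus ?thesis by eventually_elim (use eq in \<open>auto simp: Z0_def \<Phi>_def\<close>)
    qed
    show "Z0 meromorphic_on strip \<eta>"
      by (subst meromorphic_on_cong[OF ev refl]) (use meromorphic_strip_formula[OF H] in \<open>auto simp: \<Phi>_def\<close>)
  qed
  also have "{s. Re s > \<alpha>} \<union> strip \<eta> = {s. Re s > \<eta>}"
    using \<eta> genus_bounds by auto
  finally have mero: "Z0 meromorphic_on {s. Re s > \<eta>}" .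
  have sub: "{s. Re s > \<alpha>} \<subseteq> {s. Re s > \<eta>}" using \<eta> by auto
  show ?thesis
    unfolding \<eta>_def[symmetric]
    by (rule zeta_continuationI[OF open_halfspace_Re_gt sub mero]) (simp add: Z0_def)
qed

lemma zeta_continuation_unique:
  assumes Z1: "zeta_continuation a \<psi> \<alpha> U1 Z1" and Z2: "zeta_continuation a \<psi> \<alpha> U2 Z2"
    and U: "{s. Re s > \<eta>} \<subseteq> U1" "{s. Re s > \<eta>} \<subseteq> U2" and \<eta>: "\<eta> \<le> \<alpha>" and s: "Re s > \<eta>"
  shows "Z1 s = Z2 s"
proof -
  have N1: "Z1 nicely_meromorphic_on {s. Re s > \<eta>}" and N2: "Z2 nicely_meromorphic_on {s. Re s > \<eta>}"
    using Z1 Z2 U nicely_meromorphic_on_subset unfolding zeta_continuation_def by blast+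
  have "eventually (\<lambda>s. Z1 s = Z2 s) (at s)"
  proof (rule meromorphic_identity[where W = "{s. Re s > \<alpha>}" and w = "of_real (\<alpha> + 1)"])
    show "connected {s. Re s > \<eta>}" by (rule connected_halfspace_Re_gt)
  qed (use N1 N2 Z1 Z2 \<eta> s in \<open>auto simp: nicely_meromorphic_on_def zeta_continuation_def open_halfspace_Re_gt\<close>)
  from nicely_meromorphic_eqI[OF N1 N2 _ this] s show ?thesis by simp
qed

text \<open>
  The half-planes \<open>V k\<close> exhaust the plane, and by uniqueness the continuations to them are compatible.
\<close>
lemma zeta_continuation_UNIV_exists:
  assumes "\<And>k. \<exists>N\<ge>k. \<exists>M. \<exists>\<delta>>0. log_expansion L \<psi> \<epsilon> \<alpha> m d N M \<delta>"
  shows "\<exists>Z. zeta_continuation a \<psi> \<alpha> UNIV Z"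
proof -
  define V where "V = (\<lambda>k::nat. {s. Re s > \<alpha> - real k / real m})"
  have "\<exists>Z. zeta_continuation a \<psi> \<alpha> (V k) Z" for k
  proof -
    obtain N M \<delta> where N: "N \<ge> k" "\<delta> > 0" "log_expansion L \<psi> \<epsilon> \<alpha> m d N M \<delta>" using assms by blast
    then obtain Z where "zeta_continuation a \<psi> \<alpha> {s. Re s > \<alpha> - real N / real m - \<delta>} Z"
      using zeta_continuation_exists by blast
    moreover have "real k / real m \<le> real N / real m" using N by (intro divide_right_mono) auto
    hence "V k \<subseteq> {s. Re s > \<alpha> - real N / real m - \<delta>}" using N(2) by (auto simp: V_def)
    ultimately show ?thesis
      unfolding zeta_continuation_def using nicely_meromorphic_on_subset by blast
  qed
  then obtain Y where Y: "\<And>k. zeta_continuation a \<psi> \<alpha> (V k) (Y k)" by metis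
  have V_mono: "V k \<subseteq> V l" if "k \<le> l" for k l
  proof -
    have "real k / real m \<le> real l / real m" using that by (intro divide_right_mono) auto
    thus ?thesis by (auto simp: V_def)
  qed
  have Y_eq: "Y k s = Y l s" if "s \<in> V k" "k \<le> l" for k l s
  proof (rule zeta_continuation_unique[OF Y Y, of "\<alpha> - real k / real m"])
    show "{s. \<alpha> - real k / real m < Re s} \<subseteq> V k" by (simp add: V_def)
    thus "{s. \<alpha> - real k / real m < Re s} \<subseteq> V l" using V_mono[OF that(2)] by (rule order_trans)
  qed (use that(1) in \<open>simp_all add: V_def\<close>)
  have Y_eq': "Y k s = Y l s" if "s \<in> V k" "s \<in> V l" for k l s
    using that Y_eq by (metis nat_le_linear)
  have ex: "\<exists>k. s \<in> V k" for s
  proof -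
    obtain k :: nat where "real k > real m * (\<alpha> - Re s)" using reals_Archimedean2 by blast
    hence "s \<in> V k" using m by (simp add: V_def field_simps)
    thus ?thesis ..
  qed
  define Z0 where "Z0 = (\<lambda>s. Y (SOME k. s \<in> V k) s)"
  have Z0: "Z0 s = Y k s" if "s \<in> V k" for s k
    unfolding Z0_def by (rule Y_eq'[OF someI_ex[OF ex] that])
  have "Z0 meromorphic_on (\<Union>k. V k)"
  proof (rule meromorphic_on_UN)
    fix k
    have openV: "open (V k)" unfolding V_def by (rule open_halfspace_Re_gt)
    have "eventually (\<lambda>w. Z0 w = Y k w) (at z)" if "z \<in> V k" for z
    proof -
      have "eventually (\<lambda>w. w \<in> V k) (at z)"
        using that openV by (intro eventually_at_in_open') auto
      thus ?thesis by eventually_elim (rule Z0)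
    qed
    thus "Z0 meromorphic_on V k"
      by (subst meromorphic_on_cong[OF _ refl, of _ _ "Y k"])
         (use Y in \<open>auto simp: zeta_continuation_def nicely_meromorphic_on_def\<close>)
  qed
  also have "(\<Union>k. V k) = UNIV" using ex by blast
  finally have mero: "Z0 meromorphic_on UNIV" .
  have "Z0 s = seq_zeta a \<psi> s" if "Re s > \<alpha>" for s
    using Z0[of s 0] Y[of 0] that by (simp add: V_def zeta_continuation_def)
  thus ?thesis by (rule zeta_continuationI[OF open_UNIV subset_UNIV mero])
qed

text \<open>
  At an integer the sine has a simple zero, and \<open>cos (\<pi>n) e^(\<i>\<pi>n) = 1\<close>, so the derivative of the factor is \<open>n\<close>.
\<close>
lemma mellin_factor_expansion:
  obtains T where "isCont T (of_int n)" "T (of_int n) = of_int n"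
    "\<And>s. s \<noteq> of_int n \<Longrightarrow> mellin_factor s = (s - of_int n) * T s"
proof -
  define z :: complex where "z = of_int n"
  define T where "T = (\<lambda>s. if s = z then of_int n else mellin_factor s / (s - z))"
  have "sin (of_real pi * z) = 0"
  proof -
    have "of_real pi * z = of_real (pi * of_int n)" by (simp add: z_def)
    thus ?thesis by (simp only: sin_of_real) simp
  qed
  moreover have "cos (of_real pi * z) * exp (z * (\<i> * of_real pi)) = 1"
  proof -
    have "cos (of_real pi * z) * exp (z * (\<i> * of_real pi)) = exp (of_real pi * z * \<i>) * exp (of_real pi * z * \<i>)"
      using \<open>sin (of_real pi * z) = 0\<close> exp_Euler[of "of_real pi * z"] by (simp add: mult_ac)
    also have "\<dots> = exp ((2 * of_int n * of_real pi) * \<i>)"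
      by (simp add: z_def algebra_simps flip: exp_add)
    also have "\<dots> = 1" using exp_integer_2pi[of "real_of_int n"] by simp
    finally show ?thesis .
  qed
  ultimately have "(mellin_factor has_field_derivative z) (at z)" "mellin_factor z = 0"
    unfolding mellin_factor_def
    by (auto intro!: derivative_eq_intros)
  hence "((\<lambda>s. mellin_factor s / (s - z)) \<longlongrightarrow> z) (at z)"
    by (simp add: has_field_derivative_iff)
  hence "(T \<longlongrightarrow> z) (at z)"
    by (rule Lim_transform_eventually) (auto simp: T_def eventually_at_filter)
  hence "isCont T z" by (simp add: isCont_def T_def z_def)
  thus ?thesis by (intro that[of T]) (auto simp: T_def z_def)
qed

text \<open>
  The strip formula holds near \<open>n\<close> by the identity theorem. Of the indices with \<open>\<beta>\<^sub>i = n\<close> and \<open>k\<^sub>i = 0\<close> there is at most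
  one from the expansion, \<open>j = m(\<alpha> - n)\<close>, and one from \<open>\<omega>\<close> if \<open>n \<ge> 1\<close>, because then \<open>n \<le> \<lfloor>\<alpha>\<rfloor>\<close>.
\<close>
lemma zeta_value:
  assumes exp: "log_expansion L \<psi> \<epsilon> \<alpha> m d N M \<delta>" and \<delta>: "\<delta> > 0"
    and Z: "zeta_continuation a \<psi> \<alpha> {s. Re s > \<alpha> - real N / real m - \<delta>} Z"
    and n: "n \<noteq> 0" "real_of_int n \<le> \<alpha>" "real_of_int n > \<alpha> - real N / real m - \<delta>"
    and reg: "Z analytic_on {of_int n}"
  shows "zeta_value_formula Z \<alpha> m d b {0..N} n"
proof -
  define \<eta> where "\<eta> = \<alpha> - real N / real m - \<delta>"
  define z :: complex where "z = of_int n"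
  have \<eta>: "\<eta> \<le> \<alpha>"
    unfolding \<eta>_def using \<delta> divide_nonneg_nonneg[of "real N" "real m"] by linarith
  obtain H e where H: "H holomorphic_on strip \<eta>"
    and eq: "\<And>s. \<alpha> < Re s \<Longrightarrow> Re s < real genus + 1 \<Longrightarrow>
       seq_zeta a \<psi> s = mellin_factor s *
         (H s + (\<Sum>i\<in>pole_index N M. pole_coeff e i *
             (fact (log_power i) / (s - of_real (pole_point i)) ^ Suc (log_power i))))"
    using zeta_on_strip[OF exp \<delta>] unfolding \<eta>_def by blast
  have zs: "z \<in> strip \<eta>" using n genus_bounds by (simp add: z_def \<eta>_def)
  have "Z meromorphic_on strip \<eta>"
    using Z unfolding zeta_continuation_def nicely_meromorphic_on_def \<eta>_def
    by (auto intro: meromorphic_on_subset)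
  hence ev: "eventually (\<lambda>s. Z s = mellin_factor s *
         (H s + (\<Sum>i\<in>pole_index N M. pole_coeff e i *
             (fact (log_power i) / (s - of_real (pole_point i)) ^ Suc (log_power i))))) (at z)"
    by (rule meromorphic_identity[OF _ meromorphic_strip_formula[OF H] open_strip connected_strip
          open_strip[of \<alpha>] _ _ _ zs, where w = "of_real ((\<alpha> + real genus + 1) / 2)"])
       (use Z eq \<eta> genus_bounds in \<open>auto simp: zeta_continuation_def\<close>)
  \<comment> \<open>split off the simple zero of the factor in front, so that \<open>value_at_regular_point\<close> applies\<close>
  obtain T where T: "isCont T z" "T z = of_int n"
    "\<And>s. s \<noteq> z \<Longrightarrow> mellin_factor s = (s - z) * T s"
    using mellin_factor_expansion[of n] unfolding z_def by blast
  have "eventually (\<lambda>s. s \<noteq> z) (at z)" by (simp add: eventually_at_filter)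
  with ev have ev': "eventually (\<lambda>s. Z s = (s - z) * T s *
         (H s + (\<Sum>i\<in>pole_index N M. pole_coeff e i *
             (fact (log_power i) / (s - of_real (pole_point i)) ^ Suc (log_power i))))) (at z)"
    by eventually_elim (use T(3) in simp)
  have "isCont H z"
    using H zs open_strip by (meson continuous_on_eq_continuous_at holomorphic_on_imp_continuous_on)
  moreover have "isCont Z z"
    using reg unfolding z_def by (rule analytic_at_imp_isCont)
  ultimately have "Z z = T z * (\<Sum>i\<in>{i\<in>pole_index N M. of_real (pole_point i) = z \<and> log_power i = 0}. pole_coeff e i)"
    using n by (intro value_at_regular_point[OF finite_pole_index T(1) _ _ _ ev']) (auto simp: T(2))
  also have "{i\<in>pole_index N M. of_real (pole_point i) = z \<and> log_power i = 0} =
             {i\<in>pole_index N M. pole_point i = real_of_int n \<and> log_power i = 0}"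
  proof -
    have "of_real x = z \<longleftrightarrow> x = real_of_int n" for x
      unfolding z_def by (metis of_real_eq_iff of_real_of_int_eq)
    thus ?thesis by simp
  qed
  also have "(\<Sum>i\<in>\<dots>. pole_coeff e i) =
      (\<Sum>i\<in>pole_index N M. if pole_point i = real_of_int n \<and> log_power i = 0 then pole_coeff e i else 0)"
    by (rule sum.inter_filter[OF finite_pole_index])
  also have "\<dots> = (\<Sum>j=0..N. if \<alpha> - real j / real m = real_of_int n then d j 0 else 0) +
                  (\<Sum>j=0..genus. if real j = real_of_int n then - b j else 0)"
  proof -
    have "(\<Sum>k=0..M. if \<alpha> - real j / real m = real_of_int n \<and> k = 0 then d j k else 0) =
          (if \<alpha> - real j / real m = real_of_int n then d j 0 else 0)" for j
      by (cases "\<alpha> - real j / real m = real_of_int n") auto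
    moreover have "(\<Sum>j=0..genus. if real j = real_of_int n then if j = 0 then e else - b j else 0) =
                   (\<Sum>j=0..genus. if real j = real_of_int n then - b j else 0)"
      using n by (intro sum.cong) auto
    ultimately show ?thesis
      unfolding sum_pole_index pole_point_def log_power_def pole_coeff_def by (simp cong: if_cong)
  qed
  also have "(\<Sum>j=0..genus. if real j = real_of_int n then - b j else 0) = (if n \<ge> 1 then - b (nat n) else 0)"
  proof (cases "n \<ge> 1")
    case True
    have "nat n \<le> genus" using n True genus_bounds by linarith
    have "(\<Sum>j=0..genus. if real j = real_of_int n then - b j else 0) =
          (\<Sum>j=0..genus. if j = nat n then - b j else 0)"
      using True by (intro sum.cong refl if_cong) linarith+
    thus ?thesis using True \<open>nat n \<le> genus\<close> by simp
  next
    case False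
    thus ?thesis using n by (auto intro!: sum.neutral)
  qed
  finally have val: "Z (of_int n) = of_int n * ((\<Sum>j=0..N. if \<alpha> - real j / real m = real_of_int n then d j 0 else 0) +
      (if n \<ge> 1 then - b (nat n) else 0))"
    by (simp add: T(2)[unfolded z_def] z_def)
  have none: "(\<Sum>j=0..N. if \<alpha> - real j / real m = real_of_int n then d j 0 else 0) = 0"
    if "\<forall>j\<in>{0..N}. \<alpha> - real j / real m \<noteq> real_of_int n"
    using that by (intro sum.neutral) auto
  have one: "(\<Sum>j=0..N. if \<alpha> - real j / real m = real_of_int n then d j 0 else 0) = d i 0"
    if "i \<in> {0..N}" "\<alpha> - real i / real m = real_of_int n" for i
  proof -
    have "\<alpha> - real j / real m = real_of_int n \<longleftrightarrow> j = i" for j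
    proof -
      have "\<alpha> - real j / real m = real_of_int n \<longleftrightarrow> real j / real m = real i / real m"
        using that(2) by linarith
      thus ?thesis using m by simp
    qed
    thus ?thesis using that(1) by simp
  qed
  show ?thesis
    unfolding zeta_value_formula_def using val none one by auto
qed

end

theorem theorem3p7:
  fixes a :: "nat \<Rightarrow> complex" and \<alpha> \<epsilon> \<psi> :: real
    and F L :: "complex \<Rightarrow> complex" and b c :: "nat \<Rightarrow> complex"
    and m :: nat and d :: "nat \<Rightarrow> nat \<Rightarrow> complex"
  assumes a1_pos: "0 < norm (a 1)"
    and a_mono: "\<And>n. n \<ge> 1 \<Longrightarrow> norm (a n) \<le> norm (a (Suc n))"
    and a_unbounded: "filterlim (\<lambda>n. norm (a n)) at_top sequentially"
    and alpha: "limsup (\<lambda>n. ereal (ln (real n) / ln (norm (a n)))) = ereal \<alpha>"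
    and eps: "\<epsilon> > 0" and psi: "- pi \<le> \<psi>" "\<psi> < pi"
    and a_sector: "\<And>n. n \<ge> 1 \<Longrightarrow> a n \<notin> ray_sector \<psi> \<epsilon>"
    and F_char: "min_order_char_fun a \<alpha> F"
    and F_series: "\<And>z. (\<lambda>j. c j * z ^ j) sums F z"
    and b_1: "b 1 = c 1 / c 0"
    and b_rec: "\<And>j. j \<ge> 2 \<Longrightarrow>
      b j = c j / c 0 - (\<Sum>l=1..j-1. of_nat l / of_nat j * (c (j - l) / c 0) * b l)"
    and L_holo: "L holomorphic_on ray_sector \<psi> \<epsilon>"
    and L_log: "\<And>z. z \<in> ray_sector \<psi> \<epsilon> \<Longrightarrow> exp (L z) = F z"
    and m: "m \<ge> 1"
  shows "((\<forall>N\<^sub>0. \<exists>N\<ge>N\<^sub>0. \<exists>M. \<exists>\<delta>>0. log_expansion L \<psi> \<epsilon> \<alpha> m d N M \<delta>) \<longrightarrow>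
            (\<exists>Z. zeta_continuation a \<psi> \<alpha> UNIV Z) \<and>
            (\<forall>Z n. zeta_continuation a \<psi> \<alpha> UNIV Z \<and> n \<noteq> 0 \<and> real_of_int n \<le> \<alpha> \<and>
               Z analytic_on {of_int n} \<longrightarrow> zeta_value_formula Z \<alpha> m d b UNIV n)) \<and>
         (\<forall>N M \<delta>. \<delta> > 0 \<and> real N / real m > \<alpha> - \<delta> \<and> log_expansion L \<psi> \<epsilon> \<alpha> m d N M \<delta> \<longrightarrow>
            (let U = {s. Re s > \<alpha> - real N / real m - \<delta>} in
             (\<exists>Z. zeta_continuation a \<psi> \<alpha> U Z) \<and>
             (\<forall>Z n. zeta_continuation a \<psi> \<alpha> U Z \<and> n \<noteq> 0 \<and> real_of_int n \<le> \<alpha> \<and>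
                real_of_int n > \<alpha> - real N / real m - \<delta> \<and> Z analytic_on {of_int n} \<longrightarrow>
                zeta_value_formula Z \<alpha> m d b {0..N} n)))"
proof -
  interpret char_fun_setting a \<alpha> \<epsilon> \<psi> F L b c m d
    by unfold_locales (fact assms)+
  have all_orders_value: "zeta_value_formula Z \<alpha> m d b UNIV n"
    if all_orders: "\<forall>N\<^sub>0. \<exists>N\<ge>N\<^sub>0. \<exists>M. \<exists>\<delta>>0. log_expansion L \<psi> \<epsilon> \<alpha> m d N M \<delta>"
      and Z: "zeta_continuation a \<psi> \<alpha> UNIV Z"
      and n: "n \<noteq> 0" "real_of_int n \<le> \<alpha>" "Z analytic_on {of_int n}" for Z n
  proof -
    have formula: "\<exists>N\<ge>N\<^sub>0. zeta_value_formula Z \<alpha> m d b {0..N} n" for N\<^sub>0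
    proof -
      obtain k :: nat where k: "real k > real m * (\<alpha> - real_of_int n)" using reals_Archimedean2 by blast
      obtain N M \<delta> where N: "N \<ge> max N\<^sub>0 k" "\<delta> > 0" "log_expansion L \<psi> \<epsilon> \<alpha> m d N M \<delta>"
        using all_orders by blast
      have "real m * (\<alpha> - real_of_int n) < real N" using k N(1) by linarith
      hence "\<alpha> - real_of_int n < real N / real m" using m by (simp add: field_simps)
      moreover have "zeta_continuation a \<psi> \<alpha> {s. Re s > \<alpha> - real N / real m - \<delta>} Z"
        using Z by (auto simp: zeta_continuation_def intro: nicely_meromorphic_on_subset)
      ultimately have "zeta_value_formula Z \<alpha> m d b {0..N} n"
        using N(2) n by (intro zeta_value[OF N(3,2)]) auto
      thus ?thesis using N(1) by auto
    qed
    obtain N where N: "zeta_value_formula Z \<alpha> m d b {0..N} n" using formula[of 0] by blast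
    have "Z (of_int n) = of_int n * (d j 0 - b (nat n))"
      if "1 \<le> n" "\<alpha> - real j / real m = real_of_int n" for j
    proof -
      obtain N where "N \<ge> j" "zeta_value_formula Z \<alpha> m d b {0..N} n" using formula by blast
      thus ?thesis using that by (auto simp: zeta_value_formula_def)
    qed
    moreover have "Z (of_int n) = of_int n * d j 0"
      if "n < 0" "\<alpha> - real j / real m = real_of_int n" for j
    proof -
      obtain N where "N \<ge> j" "zeta_value_formula Z \<alpha> m d b {0..N} n" using formula by blast
      thus ?thesis using that by (auto simp: zeta_value_formula_def)
    qed
    ultimately show ?thesis using N by (auto simp: zeta_value_formula_def)
  qed
  have all_orders_exists: "\<exists>Z. zeta_continuation a \<psi> \<alpha> UNIV Z"
    if "\<forall>N\<^sub>0. \<exists>N\<ge>N\<^sub>0. \<exists>M. \<exists>\<delta>>0. log_expansion L \<psi> \<epsilon> \<alpha> m d N M \<delta>"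
    using that by (intro zeta_continuation_UNIV_exists) blast
  have finite_order: "(\<exists>Z. zeta_continuation a \<psi> \<alpha> {s. Re s > \<alpha> - real N / real m - \<delta>} Z) \<and>
      (\<forall>Z n. zeta_continuation a \<psi> \<alpha> {s. Re s > \<alpha> - real N / real m - \<delta>} Z \<and> n \<noteq> 0 \<and>
         real_of_int n \<le> \<alpha> \<and> real_of_int n > \<alpha> - real N / real m - \<delta> \<and>
         Z analytic_on {of_int n} \<longrightarrow> zeta_value_formula Z \<alpha> m d b {0..N} n)"
    if "\<delta> > 0" "log_expansion L \<psi> \<epsilon> \<alpha> m d N M \<delta>" for N M \<delta>
    using zeta_continuation_exists[OF that(2,1)] zeta_value[OF that(2,1)] by simp
  show ?thesis
    unfolding Let_def by (intro conjI allI impI; (elim conjE)?) (simp_all only: all_orders_value all_orders_exists finite_order simp_thms)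
qed

end
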